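(* Suppose Decomposition and Ignorability, Equicontinuity, Regularity, Existence, Bounded tails and the Slater condition (all defined in the context) hold. Suppose the mapping from $(z,x)$ to the conditional distribution $f(z,x)$ of $Y$ given $(z,x)$ is $L_f$-Lipschitz continuous under the 1-Wasserstein distance, and that for all $\xi$ and all $(z,x)$ the probability density function of $\psi_\xi(z,Y)$, $Y\sim f(z,x)$, is bounded above by a common constant. Then for a weight function that has strongly (respectively weakly) uniform consistency: 1. (Accuracy) For every $x\in\mathcal X$, for some optimal solution $z^*$ of the true problem there exists a sequence $z^n=(z_1^n,z_2^n)\in\hat P(x)$ (with $\hat P(x)$ built from $n$ data points) such that $z^n\to z^*$ almost surely (respectively in probability), and $\hat L(z^n\mid X=x)$ converges to $L(z^*\mid X=x)$ almost surely (respectively in probability). 2. (Optimality) $L(z^n\mid X=x)$ converges to $L(z^*\mid X=x)$ almost surely (respectively in probability).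
   Context: Model. Decisions $z\in\mathcal Z$, contexts $x\in\mathcal X\subseteq\mathbb R^{d^x}$, outcomes $y\in\mathcal Y$. Given decision $z$ and context $x$, the outcome $Y$ has conditional density $f(\cdot\mid z,x)$. For a loss $l(z;y)$ and constraint functions $\psi_\xi(z,y)$ with risk levels $\alpha_\xi\in(0,1)$, $\xi=1,\dots,\Xi$, put $L(z\mid X=x)=E_{Y\sim f(\cdot\mid z,x)}[l(z;Y)]$ and $g_\xi(z\mid X=x)=\mathbb P_{Y\sim f(\cdot\mid z,x)}(\psi_\xi(z,Y)\le 0)$. The true problem is: minimize $L(z\mid X=x)$ over $z\in\mathcal Z$ subject to $g_\xi(z\mid X=x)\ge1-\alpha_\xi$ for all $\xi$. Approximation. From historical data $S_N=\{(z_i,x_i,y_i)\}_{i=1}^N$ and weights $w_i(z,x)\ge0$, $\sum_i w_i(z,x)=1$, put $\hat L(z\mid X=x)=\sum_i w_i(z,x)\,l(z;y_i)$, $\hat g_\xi(z\mid X=x)=\sum_i w_i(z,x)\,\mathbb I\{\psi_\xi(z,y_i)\le0\}$ and $\hat P(x)=\{z\in\mathcal Z:\hat g_\xi(z\mid X=x)\ge1-\alpha_\xi\ \forall\xi\}$. Uniform consistency: the weight function has strongly uniform consistency if for any $x$, $\sup_{z\in\mathcal Z}|L(z\mid X=x)-\hat L(z\mid X=x)|\to0$ and $\sup_{z\in\mathcal Z}|g_\xi(z\mid X=x)-\hat g_\xi(z\mid X=x)|\to0$ for all $\xi$, almost surely as $N\to\infty$; weakly uniform consistency if the convergences hold in probability.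 Decomposition and Ignorability: $z=(z_1,z_2)\in\mathcal Z=\mathcal Z_1\times\mathcal Z_2$; only $z_1$ affects uncertainty, i.e. $Y(z_1,z_2)=Y(z_1,z_2')$ for all $(z_1,z_2),(z_1,z_2')\in\mathcal Z$; and for every $z\in\mathcal Z$, $Y(z)$ is independent of $Z$ conditioned on $X$. $\mathcal Z_1,\mathcal Z_2,\mathcal X$ have dimensions $d^{z_1},d^{z_2},d^x$. Weights depend on $(z,x)$ only through $(z_1,x)$. Equicontinuity: $l(z;y)$ and each $\psi_\xi(z;y)$ are equicontinuous in $z$: for any $z\in\mathcal Z$, $y\in\mathcal Y$, $\epsilon>0$ there is $\delta>0$ with $|l(z;y)-l(z';y)|\le\epsilon$ for all $z'$ with $\|z-z'\|\le\delta$; likewise for $\psi_\xi$. Regularity: (i) $\mathcal X,\mathcal Y,\mathcal Z$ are compact and bounded; (ii) $(z_i,x_i,y_i)$ are i.i.d. samples from a joint distribution with density $f(z,x,y)$; (iii) the joint density is continuous with $0<c<f(z,x,y)<C$ for constants $c,C$, and the marginal density $\int_{\mathcal Y}f(z,x,y)\,dy$ is twice continuously differentiable. Existence: $\hat P(x)$ is non-empty and compact for all $x$. Bounded tails: there is $\lambda>0$ with $\sup_{z\in\mathcal Z,x\in\mathcal X}E\big[\exp(\lambda|l(z;Y)-E[l(z;Y)\mid X=x,Z_1=z_1]|)\mid X=x,Z_1=z_1\big]<\infty$, where $z_1$ is the first component of $z$. Slater condition: for any given $x$ there is an optimal solution $z^*$ of the true problem such that for all $\epsilon>0$ there is $z\in\mathcal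 Z$ with $\|z-z^*\|\le\epsilon$ and $g_\xi(z\mid X=x)>1-\alpha_\xi$ for all $\xi=1,\dots,\Xi$. *)

theory Defs
  imports "HOL-Probability.Probability"
begin

section \<open>Modes of convergence\<close>

text \<open>
  Suprema over uncountable sets and selections from random sets need not be measurable, so
  convergence in probability is stated with the outer measure. If the events concerned are
  measurable, \<^const>\<open>outer_measure_of\<close> coincides with \<^const>\<open>emeasure\<close>
  and this is the usual notion.
\<close>

definition vanishes_in_prob :: "'w measure \<Rightarrow> (nat \<Rightarrow> 'w \<Rightarrow> ennreal) \<Rightarrow> bool" where
  "vanishes_in_prob M D \<longleftrightarrow>
     (\<forall>\<epsilon>>0. (\<lambda>n. outer_measure_of M {\<omega> \<in> space M. D n \<omega> > ennreal \<epsilon>}) \<longlonglongrightarrow> 0)"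

definition tends_in_prob :: "'w measure \<Rightarrow> (nat \<Rightarrow> 'w \<Rightarrow> 'a::metric_space) \<Rightarrow> 'a \<Rightarrow> bool" where
  "tends_in_prob M U c \<longleftrightarrow> vanishes_in_prob M (\<lambda>n \<omega>. ennreal (dist (U n \<omega>) c))"

definition tends_almost_surely ::
  "'w measure \<Rightarrow> (nat \<Rightarrow> 'w \<Rightarrow> 'a::topological_space) \<Rightarrow> 'a \<Rightarrow> bool" where
  "tends_almost_surely M U c \<longleftrightarrow> (AE \<omega> in M. (\<lambda>n. U n \<omega>) \<longlonglongrightarrow> c)"

text \<open>The supremum is taken in \<^typ>\<open>ennreal\<close>, so that it is infinite, rather than
  unspecified, for unbounded differences.\<close>

definition sup_dev :: "'z set \<Rightarrow> ('z \<Rightarrow> real) \<Rightarrow> ('z \<Rightarrow> real) \<Rightarrow> ennreal" where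
  "sup_dev Z u v = (SUP z\<in>Z. ennreal \<bar>u z - v z\<bar>)"


section \<open>Conditional laws derived from a joint density\<close>

text \<open>
  The function \<open>f\<close> gives the joint density on \<open>Z \<times> X \<times> Y\<close>; its values
  outside this set are irrelevant.
\<close>

definition joint_density :: "('z \<times> 'x \<times> 'y) set \<Rightarrow> ('z \<times> 'x \<times> 'y \<Rightarrow> real) \<Rightarrow> 'z \<times> 'x \<times> 'y \<Rightarrow> ennreal" where
  "joint_density S f p = ennreal (f p) * indicator S p"

definition marginal_zx ::
  "'y::euclidean_space set \<Rightarrow> ('z \<times> 'x \<times> 'y \<Rightarrow> real) \<Rightarrow> 'z \<Rightarrow> 'x \<Rightarrow> real" where
  "marginal_zx Y f z x = (LINT y:Y|lborel. f (z, x, y))"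

definition marginal_x ::
  "'z::euclidean_space set \<Rightarrow> 'y::euclidean_space set \<Rightarrow> ('z \<times> 'x \<times> 'y \<Rightarrow> real) \<Rightarrow> 'x \<Rightarrow> real" where
  "marginal_x Z Y f x = (LINT z:Z|lborel. marginal_zx Y f z x)"

definition cond_density ::
  "'y::euclidean_space set \<Rightarrow> ('z \<times> 'x \<times> 'y \<Rightarrow> real) \<Rightarrow> 'z \<Rightarrow> 'x \<Rightarrow> 'y \<Rightarrow> real" where
  "cond_density Y f z x y = f (z, x, y) / marginal_zx Y f z x"

definition cond_law ::
  "'y::euclidean_space set \<Rightarrow> ('z \<times> 'x \<times> 'y \<Rightarrow> real) \<Rightarrow> 'z \<Rightarrow> 'x \<Rightarrow> 'y measure" where
  "cond_law Y f z x =
     density (restrict_space lborel Y) (\<lambda>y. ennreal (cond_density Y f z x y))"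

text \<open>The conditional law of the outcome given only the first decision component and the
  context: the second decision component is integrated out of the joint density.\<close>

definition cond_law_fst ::
  "'b::euclidean_space set \<Rightarrow> 'y::euclidean_space set \<Rightarrow> (('a \<times> 'b) \<times> 'x \<times> 'y \<Rightarrow> real) \<Rightarrow>
   'a \<Rightarrow> 'x \<Rightarrow> 'y measure" where
  "cond_law_fst Z2 Y f z1 x =
     density (restrict_space lborel Y)
       (\<lambda>y. ennreal ((LINT z2:Z2|lborel. f ((z1, z2), x, y)) /
                    (LINT z2:Z2|lborel. marginal_zx Y f (z1, z2) x)))"


section \<open>The true problem and its data-driven approximation\<close>

definition exp_loss ::
  "'y::euclidean_space set \<Rightarrow> ('z \<times> 'x \<times> 'y \<Rightarrow> real) \<Rightarrow> ('z \<Rightarrow> 'y \<Rightarrow> real) \<Rightarrow> 'z \<Rightarrow> 'x \<Rightarrow> real" where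
  "exp_loss Y f l z x = (\<integral>y. l z y \<partial>cond_law Y f z x)"

definition sat_prob ::
  "'y::euclidean_space set \<Rightarrow> ('z \<times> 'x \<times> 'y \<Rightarrow> real) \<Rightarrow> ('z \<Rightarrow> 'y \<Rightarrow> real) \<Rightarrow> 'z \<Rightarrow> 'x \<Rightarrow> real" where
  "sat_prob Y f q z x = measure (cond_law Y f z x) {y \<in> Y. q z y \<le> 0}"

definition feasible ::
  "'z set \<Rightarrow> 'y::euclidean_space set \<Rightarrow> ('z \<times> 'x \<times> 'y \<Rightarrow> real) \<Rightarrow> nat \<Rightarrow> (nat \<Rightarrow> real) \<Rightarrow>
   (nat \<Rightarrow> 'z \<Rightarrow> 'y \<Rightarrow> real) \<Rightarrow> 'x \<Rightarrow> 'z set" where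
  "feasible Z Y f \<Xi> \<alpha> \<psi> x = {z \<in> Z. \<forall>\<xi>\<in>{1..\<Xi>}. sat_prob Y f (\<psi> \<xi>) z x \<ge> 1 - \<alpha> \<xi>}"

definition optimal ::
  "'z set \<Rightarrow> 'y::euclidean_space set \<Rightarrow> ('z \<times> 'x \<times> 'y \<Rightarrow> real) \<Rightarrow> ('z \<Rightarrow> 'y \<Rightarrow> real) \<Rightarrow> nat \<Rightarrow>
   (nat \<Rightarrow> real) \<Rightarrow> (nat \<Rightarrow> 'z \<Rightarrow> 'y \<Rightarrow> real) \<Rightarrow> 'x \<Rightarrow> 'z \<Rightarrow> bool" where
  "optimal Z Y f l \<Xi> \<alpha> \<psi> x z \<longleftrightarrow>
     z \<in> feasible Z Y f \<Xi> \<alpha> \<psi> x \<and>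
     (\<forall>z'\<in>feasible Z Y f \<Xi> \<alpha> \<psi> x. exp_loss Y f l z x \<le> exp_loss Y f l z' x)"

text \<open>
  \<open>W \<omega> N i z x\<close> is the weight of observation \<open>i\<close> in the approximation with
  \<open>N\<close> observations. Weights are random through \<open>\<omega>\<close>; this covers weights computed
  from the data, with or without auxiliary randomization.
\<close>

definition weight_function ::
  "'w measure \<Rightarrow> ('a \<times> 'b) set \<Rightarrow> 'x set \<Rightarrow> ('w \<Rightarrow> nat \<Rightarrow> nat \<Rightarrow> 'a \<times> 'b \<Rightarrow> 'x \<Rightarrow> real) \<Rightarrow> bool" where
  "weight_function M Z X W \<longleftrightarrow>
     (\<forall>\<omega>\<in>space M. \<forall>N\<ge>1. \<forall>x\<in>X.
        (\<forall>z\<in>Z. (\<forall>i\<in>{1..N}. W \<omega> N i z x \<ge> 0) \<and> (\<Sum>i=1..N. W \<omega> N i z x) = 1) \<and>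
        (\<forall>z\<in>Z. \<forall>z'\<in>Z. fst z = fst z' \<longrightarrow> (\<forall>i\<in>{1..N}. W \<omega> N i z x = W \<omega> N i z' x)))"

definition est_loss ::
  "('w \<Rightarrow> nat \<Rightarrow> nat \<Rightarrow> 'z \<Rightarrow> 'x \<Rightarrow> real) \<Rightarrow> (nat \<Rightarrow> 'w \<Rightarrow> 'y) \<Rightarrow> ('z \<Rightarrow> 'y \<Rightarrow> real) \<Rightarrow>
   nat \<Rightarrow> 'w \<Rightarrow> 'z \<Rightarrow> 'x \<Rightarrow> real" where
  "est_loss W ys l N \<omega> z x = (\<Sum>i=1..N. W \<omega> N i z x * l z (ys i \<omega>))"

definition est_prob ::
  "('w \<Rightarrow> nat \<Rightarrow> nat \<Rightarrow> 'z \<Rightarrow> 'x \<Rightarrow> real) \<Rightarrow> (nat \<Rightarrow> 'w \<Rightarrow> 'y) \<Rightarrow> ('z \<Rightarrow> 'y \<Rightarrow> real) \<Rightarrow>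
   nat \<Rightarrow> 'w \<Rightarrow> 'z \<Rightarrow> 'x \<Rightarrow> real" where
  "est_prob W ys q N \<omega> z x =
     (\<Sum>i=1..N. W \<omega> N i z x * (if q z (ys i \<omega>) \<le> 0 then 1 else 0))"

definition est_feasible ::
  "'z set \<Rightarrow> nat \<Rightarrow> (nat \<Rightarrow> real) \<Rightarrow> (nat \<Rightarrow> 'z \<Rightarrow> 'y \<Rightarrow> real) \<Rightarrow>
   ('w \<Rightarrow> nat \<Rightarrow> nat \<Rightarrow> 'z \<Rightarrow> 'x \<Rightarrow> real) \<Rightarrow> (nat \<Rightarrow> 'w \<Rightarrow> 'y) \<Rightarrow> nat \<Rightarrow> 'w \<Rightarrow> 'x \<Rightarrow> 'z set" where
  "est_feasible Z \<Xi> \<alpha> \<psi> W ys N \<omega> x =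
     {z \<in> Z. \<forall>\<xi>\<in>{1..\<Xi>}. est_prob W ys (\<psi> \<xi>) N \<omega> z x \<ge> 1 - \<alpha> \<xi>}"

definition strongly_uniformly_consistent ::
  "'w measure \<Rightarrow> 'z set \<Rightarrow> 'x set \<Rightarrow> 'y::euclidean_space set \<Rightarrow> ('z \<times> 'x \<times> 'y \<Rightarrow> real) \<Rightarrow>
   ('z \<Rightarrow> 'y \<Rightarrow> real) \<Rightarrow> nat \<Rightarrow> (nat \<Rightarrow> 'z \<Rightarrow> 'y \<Rightarrow> real) \<Rightarrow>
   (nat \<Rightarrow> 'w \<Rightarrow> 'y) \<Rightarrow> ('w \<Rightarrow> nat \<Rightarrow> nat \<Rightarrow> 'z \<Rightarrow> 'x \<Rightarrow> real) \<Rightarrow> bool" where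
  "strongly_uniformly_consistent M Z X Y f l \<Xi> \<psi> ys W \<longleftrightarrow>
     (\<forall>x\<in>X.
        tends_almost_surely M
          (\<lambda>N \<omega>. sup_dev Z (\<lambda>z. exp_loss Y f l z x) (\<lambda>z. est_loss W ys l N \<omega> z x)) 0 \<and>
        (\<forall>\<xi>\<in>{1..\<Xi>}. tends_almost_surely M
          (\<lambda>N \<omega>. sup_dev Z (\<lambda>z. sat_prob Y f (\<psi> \<xi>) z x) (\<lambda>z. est_prob W ys (\<psi> \<xi>) N \<omega> z x)) 0))"

definition weakly_uniformly_consistent ::
  "'w measure \<Rightarrow> 'z set \<Rightarrow> 'x set \<Rightarrow> 'y::euclidean_space set \<Rightarrow> ('z \<times> 'x \<times> 'y \<Rightarrow> real) \<Rightarrow>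
   ('z \<Rightarrow> 'y \<Rightarrow> real) \<Rightarrow> nat \<Rightarrow> (nat \<Rightarrow> 'z \<Rightarrow> 'y \<Rightarrow> real) \<Rightarrow>
   (nat \<Rightarrow> 'w \<Rightarrow> 'y) \<Rightarrow> ('w \<Rightarrow> nat \<Rightarrow> nat \<Rightarrow> 'z \<Rightarrow> 'x \<Rightarrow> real) \<Rightarrow> bool" where
  "weakly_uniformly_consistent M Z X Y f l \<Xi> \<psi> ys W \<longleftrightarrow>
     (\<forall>x\<in>X.
        vanishes_in_prob M
          (\<lambda>N \<omega>. sup_dev Z (\<lambda>z. exp_loss Y f l z x) (\<lambda>z. est_loss W ys l N \<omega> z x)) \<and>
        (\<forall>\<xi>\<in>{1..\<Xi>}. vanishes_in_prob M
          (\<lambda>N \<omega>. sup_dev Z (\<lambda>z. sat_prob Y f (\<psi> \<xi>) z x) (\<lambda>z. est_prob W ys (\<psi> \<xi>) N \<omega> z x))))"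


section \<open>Standing assumptions\<close>

definition cond_indep ::
  "'p measure \<Rightarrow> ('p \<Rightarrow> 'a::topological_space) \<Rightarrow> ('p \<Rightarrow> 'b::topological_space) \<Rightarrow>
   ('p \<Rightarrow> 'c::topological_space) \<Rightarrow> bool" where
  "cond_indep P A B C \<longleftrightarrow>
     (\<forall>S\<in>sets borel. \<forall>T\<in>sets borel. AE \<omega> in P.
        real_cond_exp P (vimage_algebra (space P) C borel) (\<lambda>\<omega>. indicator S (A \<omega>) * indicator T (B \<omega>)) \<omega> =
        real_cond_exp P (vimage_algebra (space P) C borel) (\<lambda>\<omega>. indicator S (A \<omega>)) \<omega> *
        real_cond_exp P (vimage_algebra (space P) C borel) (\<lambda>\<omega>. indicator T (B \<omega>)) \<omega>)"

text \<open>
  The population: decision \<open>ZV\<close>, context \<open>XV\<close> and potential outcomes \<open>YV z\<close>; the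
  observed outcome is \<open>YV (ZV \<omega>) \<omega>\<close>. The last conjunct says that the conditional density
  which is read off from the observed joint density is the conditional density of the outcome
  of decision \<open>z\<close> given the context. Ignorability alone does not yield this for each
  single \<open>z\<close>, because the event that \<open>ZV\<close> equals \<open>z\<close> is null.
\<close>

definition outcome_model ::
  "'p measure \<Rightarrow> 'z::euclidean_space set \<Rightarrow> 'x::euclidean_space set \<Rightarrow> 'y::euclidean_space set \<Rightarrow>
   ('z \<times> 'x \<times> 'y \<Rightarrow> real) \<Rightarrow> ('p \<Rightarrow> 'z) \<Rightarrow> ('p \<Rightarrow> 'x) \<Rightarrow> ('z \<Rightarrow> 'p \<Rightarrow> 'y) \<Rightarrow> bool" where
  "outcome_model P Z X Y f ZV XV YV \<longleftrightarrow>
     distributed P lborel (\<lambda>\<omega>. (ZV \<omega>, XV \<omega>, YV (ZV \<omega>) \<omega>)) (joint_density (Z \<times> X \<times> Y) f) \<and>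
     (\<forall>z\<in>Z. distributed P lborel (\<lambda>\<omega>. (XV \<omega>, YV z \<omega>))
        (\<lambda>(x, y). ennreal (marginal_x Z Y f x * cond_density Y f z x y) * indicator (X \<times> Y) (x, y)))"

definition decomposition_ignorability ::
  "'p measure \<Rightarrow> 'a::euclidean_space set \<Rightarrow> 'b::euclidean_space set \<Rightarrow>
   ('p \<Rightarrow> 'a \<times> 'b) \<Rightarrow> ('p \<Rightarrow> 'x::euclidean_space) \<Rightarrow> ('a \<times> 'b \<Rightarrow> 'p \<Rightarrow> 'y::euclidean_space) \<Rightarrow> bool" where
  "decomposition_ignorability P Z1 Z2 ZV XV YV \<longleftrightarrow>
     (\<forall>z1\<in>Z1. \<forall>z2\<in>Z2. \<forall>z2'\<in>Z2. AE \<omega> in P. YV (z1, z2) \<omega> = YV (z1, z2') \<omega>) \<and>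
     (\<forall>z\<in>Z1 \<times> Z2. cond_indep P (YV z) ZV XV)"

text \<open>The radius may depend on \<open>z\<close>, \<open>y\<close> and \<open>\<epsilon>\<close>.\<close>

definition equicontinuous_in_decision ::
  "'z::real_normed_vector set \<Rightarrow> 'y set \<Rightarrow> ('z \<Rightarrow> 'y \<Rightarrow> real) \<Rightarrow> bool" where
  "equicontinuous_in_decision Z Y h \<longleftrightarrow>
     (\<forall>z\<in>Z. \<forall>y\<in>Y. \<forall>\<epsilon>>0. \<exists>\<delta>>0. \<forall>z'\<in>Z. norm (z - z') \<le> \<delta> \<longrightarrow> \<bar>h z y - h z' y\<bar> \<le> \<epsilon>)"

text \<open>Derivatives are taken within the (closed) set; the restriction of a \<open>C\<^sup>2\<close> function on
  an open neighbourhood is covered.\<close>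

definition twice_cont_differentiable_on ::
  "'a::euclidean_space set \<Rightarrow> ('a \<Rightarrow> real) \<Rightarrow> bool" where
  "twice_cont_differentiable_on S h \<longleftrightarrow>
     (\<exists>(h' :: 'a \<Rightarrow> 'a \<Rightarrow>\<^sub>L real) (h'' :: 'a \<Rightarrow> 'a \<Rightarrow>\<^sub>L ('a \<Rightarrow>\<^sub>L real)).
        (\<forall>p\<in>S. (h has_derivative blinfun_apply (h' p)) (at p within S) \<and>
               (h' has_derivative blinfun_apply (h'' p)) (at p within S)) \<and>
        continuous_on S h'')"

definition regularity ::
  "'w measure \<Rightarrow> 'z::euclidean_space set \<Rightarrow> 'x::euclidean_space set \<Rightarrow> 'y::euclidean_space set \<Rightarrow>
   ('z \<times> 'x \<times> 'y \<Rightarrow> real) \<Rightarrow> (nat \<Rightarrow> 'w \<Rightarrow> 'z) \<Rightarrow> (nat \<Rightarrow> 'w \<Rightarrow> 'x) \<Rightarrow> (nat \<Rightarrow> 'w \<Rightarrow> 'y) \<Rightarrow> bool" where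
  "regularity M Z X Y f zs xs ys \<longleftrightarrow>
     compact X \<and> compact Y \<and> compact Z \<and>
     prob_space.indep_vars M (\<lambda>_. borel) (\<lambda>i \<omega>. (zs i \<omega>, xs i \<omega>, ys i \<omega>)) {1..} \<and>
     (\<forall>i\<ge>1. distributed M lborel (\<lambda>\<omega>. (zs i \<omega>, xs i \<omega>, ys i \<omega>)) (joint_density (Z \<times> X \<times> Y) f)) \<and>
     continuous_on (Z \<times> X \<times> Y) f \<and>
     (\<exists>c C. 0 < c \<and> (\<forall>p\<in>Z \<times> X \<times> Y. c < f p \<and> f p < C)) \<and>
     twice_cont_differentiable_on (Z \<times> X) (\<lambda>(z, x). marginal_zx Y f z x)"

definition existence ::
  "'w measure \<Rightarrow> 'z::topological_space set \<Rightarrow> 'x set \<Rightarrow> nat \<Rightarrow> (nat \<Rightarrow> real) \<Rightarrow>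
   (nat \<Rightarrow> 'z \<Rightarrow> 'y \<Rightarrow> real) \<Rightarrow> (nat \<Rightarrow> 'w \<Rightarrow> 'y) \<Rightarrow>
   ('w \<Rightarrow> nat \<Rightarrow> nat \<Rightarrow> 'z \<Rightarrow> 'x \<Rightarrow> real) \<Rightarrow> bool" where
  "existence M Z X \<Xi> \<alpha> \<psi> ys W \<longleftrightarrow>
     (\<forall>x\<in>X. AE \<omega> in M. \<forall>N\<ge>1.
        est_feasible Z \<Xi> \<alpha> \<psi> W ys N \<omega> x \<noteq> {} \<and> compact (est_feasible Z \<Xi> \<alpha> \<psi> W ys N \<omega> x))"

definition bounded_tails ::
  "'a::euclidean_space set \<Rightarrow> 'b::euclidean_space set \<Rightarrow> 'x set \<Rightarrow> 'y::euclidean_space set \<Rightarrow>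
   (('a \<times> 'b) \<times> 'x \<times> 'y \<Rightarrow> real) \<Rightarrow> ('a \<times> 'b \<Rightarrow> 'y \<Rightarrow> real) \<Rightarrow> bool" where
  "bounded_tails Z1 Z2 X Y f l \<longleftrightarrow>
     (\<exists>r>0. (SUP (z, x)\<in>(Z1 \<times> Z2) \<times> X.
        (\<integral>\<^sup>+y. ennreal (exp (r * \<bar>l z y - (\<integral>y'. l z y' \<partial>cond_law_fst Z2 Y f (fst z) x)\<bar>))
           \<partial>cond_law_fst Z2 Y f (fst z) x)) < \<infinity>)"

definition slater ::
  "'z::real_normed_vector set \<Rightarrow> 'x set \<Rightarrow> 'y::euclidean_space set \<Rightarrow> ('z \<times> 'x \<times> 'y \<Rightarrow> real) \<Rightarrow>
   ('z \<Rightarrow> 'y \<Rightarrow> real) \<Rightarrow> nat \<Rightarrow> (nat \<Rightarrow> real) \<Rightarrow> (nat \<Rightarrow> 'z \<Rightarrow> 'y \<Rightarrow> real) \<Rightarrow> bool" where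
  "slater Z X Y f l \<Xi> \<alpha> \<psi> \<longleftrightarrow>
     (\<forall>x\<in>X. \<exists>z_opt. optimal Z Y f l \<Xi> \<alpha> \<psi> x z_opt \<and>
        (\<forall>\<epsilon>>0. \<exists>z\<in>Z. norm (z - z_opt) \<le> \<epsilon> \<and>
                     (\<forall>\<xi>\<in>{1..\<Xi>}. sat_prob Y f (\<psi> \<xi>) z x > 1 - \<alpha> \<xi>)))"

definition wasserstein1 :: "'y::metric_space measure \<Rightarrow> 'y measure \<Rightarrow> ennreal" where
  "wasserstein1 \<mu> \<nu> =
     (INF \<pi>\<in>{\<pi>. sets \<pi> = sets (\<mu> \<Otimes>\<^sub>M \<nu>) \<and> distr \<pi> \<mu> fst = \<mu> \<and> distr \<pi> \<nu> snd = \<nu>}.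
        (\<integral>\<^sup>+p. ennreal (dist (fst p) (snd p)) \<partial>\<pi>))"

definition wasserstein_lipschitz ::
  "real \<Rightarrow> 'z::metric_space set \<Rightarrow> 'x::metric_space set \<Rightarrow> 'y::euclidean_space set \<Rightarrow>
   ('z \<times> 'x \<times> 'y \<Rightarrow> real) \<Rightarrow> bool" where
  "wasserstein_lipschitz L\<^sub>f Z X Y f \<longleftrightarrow>
     L\<^sub>f \<ge> 0 \<and>
     (\<forall>z\<in>Z. \<forall>x\<in>X. \<forall>z'\<in>Z. \<forall>x'\<in>X.
        wasserstein1 (cond_law Y f z x) (cond_law Y f z' x') \<le> ennreal (L\<^sub>f * dist (z, x) (z', x')))"

definition bounded_constraint_densities ::
  "'z set \<Rightarrow> 'x set \<Rightarrow> 'y::euclidean_space set \<Rightarrow> ('z \<times> 'x \<times> 'y \<Rightarrow> real) \<Rightarrow> nat \<Rightarrow>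
   (nat \<Rightarrow> 'z \<Rightarrow> 'y \<Rightarrow> real) \<Rightarrow> bool" where
  "bounded_constraint_densities Z X Y f \<Xi> \<psi> \<longleftrightarrow>
     (\<exists>B::real. \<forall>\<xi>\<in>{1..\<Xi>}. \<forall>z\<in>Z. \<forall>x\<in>X. \<exists>d.
        distributed (cond_law Y f z x) lborel (\<psi> \<xi> z) d \<and> (\<forall>t. d t \<le> ennreal B))"

end

theory Submission
  imports Defs
begin

text \<open>
  Fix a context \<open>x\<close> and let \<open>z_opt\<close> be the optimal solution provided by the Slater condition. The
  sequence sought is the point of the estimated feasible set that is closest to \<open>z_opt\<close>. Close to
  \<open>z_opt\<close> there is a decision that satisfies every true constraint with a positive margin; once
  the uniform error of the finitely many estimated constraints is below that margin, this decision
  is also feasible for the estimated problem, so the closest feasible point is at least as near.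
  Hence the closest points converge to \<open>z_opt\<close>.

  The true losses along the sequence then converge because the expected loss is continuous in the
  decision, and the estimated losses converge because they differ from the true ones by at most the
  uniform error of the loss.

  Continuity of the expected loss (\<open>continuous_on_exp_loss\<close>) is the analytic part.
  Equicontinuity gives convergence of \<open>l z y\<close> for each single outcome \<open>y\<close> only, with no
  uniformity in \<open>y\<close>, and the losses need not be bounded, so a uniform integrability argument is
  required. The bounded tails supply it: the exponential moments dominate second moments, and since the
  joint density is bounded above and away from zero, the conditional laws may be replaced by Lebesgue
  measure on \<open>Y\<close>. These second moments are centred at conditional means that might themselves be unbounded in the decision;
  \<open>second_moments_bounded_of_centred\<close> excludes this along a convergent sequence, and
  \<open>integral_tendsto_of_bounded_second_moments\<close> then exchanges limit and integral.

  The almost sure and the in-probability claims rest on the same deterministic implication: if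
  finitely many uniform errors are small, then the quantity of interest is close to its limit. The
  lemmas \<open>tends_almost_surely_of_control\<close> and \<open>tends_in_prob_of_control\<close> turn such an
  implication into convergence in either mode.
\<close>

section \<open>Convergence of integrals under bounded second moments\<close>

lemma square_integrable_of_nn_bound:
  fixes v :: "'a \<Rightarrow> real"
  assumes "v \<in> borel_measurable M" "0 \<le> K" "(\<integral>\<^sup>+y. ennreal ((v y)\<^sup>2) \<partial>M) \<le> ennreal K"
  shows "integrable M (\<lambda>y. (v y)\<^sup>2)" and "(\<integral>y. (v y)\<^sup>2 \<partial>M) \<le> K"
proof -
  show "integrable M (\<lambda>y. (v y)\<^sup>2)"
    using assms by (intro integrableI_nonneg) (auto simp: order_le_less_trans[OF assms(3)])
  show "(\<integral>y. (v y)\<^sup>2 \<partial>M) \<le> K"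
    using assms by (intro integral_real_bounded) auto
qed

text \<open>A special case of Vitali's convergence theorem: bounded second moments on a finite measure space
  give uniform integrability. The gap between a term and the limit is split at a level \<open>T\<close>; the
  part below \<open>T\<close> vanishes by dominated convergence, and the part above contributes at most a
  multiple of \<open>1 / T\<close>.\<close>

lemma (in finite_measure) integral_tendsto_of_bounded_second_moments:
  fixes v :: "nat \<Rightarrow> 'a \<Rightarrow> real"
  assumes v: "\<And>n. v n \<in> borel_measurable M" and v': "v' \<in> borel_measurable M"
    and lim: "\<And>y. y \<in> space M \<Longrightarrow> (\<lambda>n. v n y) \<longlonglongrightarrow> v' y"
    and K: "0 \<le> K" "\<And>n. (\<integral>\<^sup>+y. ennreal ((v n y)\<^sup>2) \<partial>M) \<le> ennreal K"
  shows "(\<lambda>n. \<integral>y. v n y \<partial>M) \<longlonglongrightarrow> (\<integral>y. v' y \<partial>M)"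
proof (rule LIMSEQ_I)
  fix \<epsilon> :: real
  assume \<epsilon>: "0 < \<epsilon>"
  note [measurable] = v v'
  \<comment> \<open>Fatou's lemma gives the limit the same second-moment bound.\<close>
  have "(\<integral>\<^sup>+y. ennreal ((v' y)\<^sup>2) \<partial>M) = (\<integral>\<^sup>+y. liminf (\<lambda>n. ennreal ((v n y)\<^sup>2)) \<partial>M)"
  proof (rule nn_integral_cong)
    fix y assume "y \<in> space M"
    then have "(\<lambda>n. ennreal ((v n y)\<^sup>2)) \<longlonglongrightarrow> ennreal ((v' y)\<^sup>2)"
      by (intro tendsto_ennrealI tendsto_power lim)
    then show "ennreal ((v' y)\<^sup>2) = liminf (\<lambda>n. ennreal ((v n y)\<^sup>2))"
      by (intro lim_imp_Liminf[symmetric]) auto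
  qed
  also have "\<dots> \<le> liminf (\<lambda>n. \<integral>\<^sup>+y. ennreal ((v n y)\<^sup>2) \<partial>M)"
    by (intro nn_integral_liminf) simp
  also have "\<dots> \<le> limsup (\<lambda>n. \<integral>\<^sup>+y. ennreal ((v n y)\<^sup>2) \<partial>M)"
    by (intro Liminf_le_Limsup) simp
  also have "\<dots> \<le> ennreal K"
    by (intro Limsup_bounded) (simp add: K)
  finally have K': "(\<integral>\<^sup>+y. ennreal ((v' y)\<^sup>2) \<partial>M) \<le> ennreal K" .
  note sq = square_integrable_of_nn_bound[OF v K(1) K(2)] square_integrable_of_nn_bound[OF v' K(1) K']
  have int: "integrable M (v n)" "integrable M v'" for n
    using square_integrable_imp_integrable[OF v sq(1)] square_integrable_imp_integrable[OF v' sq(3)]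
    by auto
  \<comment> \<open>The level at which the tail bound \<open>4 K / T\<close> drops below \<open>\<epsilon> / 2\<close>; the summand 1 keeps it positive if
    \<open>K = 0\<close>.\<close>
  define T where "T = 8 * K / \<epsilon> + 1"
  have T: "T > 0" using K(1) \<epsilon> unfolding T_def by (smt (verit) divide_nonneg_pos)
  have tail: "4 * K / T < \<epsilon> / 2"
    using T \<epsilon> K(1) unfolding T_def by (simp add: field_simps)
  define w where "w n y = \<bar>v n y - v' y\<bar>" for n y
  have [measurable]: "w n \<in> borel_measurable M" for n unfolding w_def by measurable
  have w: "w n y \<ge> 0" for n y by (simp add: w_def)
  have minabs: "\<bar>min (w n y) T\<bar> \<le> T" for n y
    using w[of n y] T by (auto simp: min_def)
  have minint: "integrable M (\<lambda>y. min (w n y) T)" for n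
    using minabs by (intro integrable_const_bound[where B=T]) (auto intro!: AE_I2)
  have "(\<lambda>n. \<integral>y. min (w n y) T \<partial>M) \<longlonglongrightarrow> (\<integral>y. 0 \<partial>M)"
  proof (rule integral_dominated_convergence[where w="\<lambda>_. T"])
    show "AE y in M. (\<lambda>n. min (w n y) T) \<longlonglongrightarrow> 0"
    proof (rule AE_I2)
      fix y assume "y \<in> space M"
      then have "(\<lambda>n. w n y) \<longlonglongrightarrow> \<bar>v' y - v' y\<bar>"
        unfolding w_def by (intro tendsto_intros lim)
      from tendsto_min[OF this tendsto_const[of T]] show "(\<lambda>n. min (w n y) T) \<longlonglongrightarrow> 0"
        using T by simp
    qed
    show "AE y in M. norm (min (w n y) T) \<le> T" for n
      using minabs by (auto intro!: AE_I2)
  qed auto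
  then obtain n0 where n0: "\<And>n. n \<ge> n0 \<Longrightarrow> (\<integral>y. min (w n y) T \<partial>M) < \<epsilon> / 2"
    using LIMSEQ_D[of "\<lambda>n. \<integral>y. min (w n y) T \<partial>M" 0 "\<epsilon>/2"] \<epsilon> by fastforce
  have "norm ((\<integral>y. v n y \<partial>M) - (\<integral>y. v' y \<partial>M)) < \<epsilon>" if "n \<ge> n0" for n
  proof -
    have sqint: "integrable M (\<lambda>y. (2 / T) * ((v n y)\<^sup>2 + (v' y)\<^sup>2))"
      using sq by (intro integrable_mult_right Bochner_Integration.integrable_add)
    have wint: "integrable M (w n)"
      unfolding w_def using int by auto
    \<comment> \<open>Above the level \<open>T\<close> the gap is at most its square divided by \<open>T\<close>.\<close>
    have bnd: "w n y \<le> min (w n y) T + (2 / T) * ((v n y)\<^sup>2 + (v' y)\<^sup>2)" for y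
    proof (cases "w n y \<le> T")
      case True
      then show ?thesis using T by simp
    next
      case False
      have "T * w n y \<le> w n y * w n y"
        using False w by (intro mult_right_mono) auto
      also have "\<dots> = (v n y - v' y)\<^sup>2"
        by (simp add: w_def power2_eq_square)
      also have "\<dots> \<le> 2 * ((v n y)\<^sup>2 + (v' y)\<^sup>2)"
        using zero_le_power2[of "v n y + v' y"] by (simp add: power2_eq_square algebra_simps)
      finally have "w n y \<le> (2 / T) * ((v n y)\<^sup>2 + (v' y)\<^sup>2)"
        using T by (simp add: field_simps)
      then show ?thesis
        using T False by simp
    qed
    have "norm ((\<integral>y. v n y \<partial>M) - (\<integral>y. v' y \<partial>M)) = norm (\<integral>y. v n y - v' y \<partial>M)"
      using int by simp
    also have "\<dots> \<le> (\<integral>y. w n y \<partial>M)"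
      unfolding w_def using int by (intro integral_abs_bound[THEN order_trans, unfolded real_norm_def[symmetric]]) simp
    also have "\<dots> \<le> (\<integral>y. min (w n y) T + (2 / T) * ((v n y)\<^sup>2 + (v' y)\<^sup>2) \<partial>M)"
      using wint minint sqint bnd by (intro integral_mono Bochner_Integration.integrable_add) auto
    also have "\<dots> = (\<integral>y. min (w n y) T \<partial>M) + (2 / T) * ((\<integral>y. (v n y)\<^sup>2 \<partial>M) + (\<integral>y. (v' y)\<^sup>2 \<partial>M))"
      using minint sqint sq by simp
    also have "\<dots> \<le> (\<integral>y. min (w n y) T \<partial>M) + (2 / T) * (K + K)"
      using sq T by (intro add_left_mono mult_left_mono add_mono) auto
    also have "\<dots> < \<epsilon> / 2 + \<epsilon> / 2"
      using n0[OF that] tail by simp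
    finally show ?thesis by simp
  qed
  then show "\<exists>n0. \<forall>n\<ge>n0. norm ((\<integral>y. v n y \<partial>M) - (\<integral>y. v' y \<partial>M)) < \<epsilon>" by blast
qed

text \<open>Functions that are bounded pointwise cannot concentrate around centres that run off to infinity:
  they are uniformly bounded on some set of positive measure, and there a large centre would force
  a large centred second moment.\<close>

lemma (in finite_measure) second_moments_bounded_of_centred:
  fixes u :: "nat \<Rightarrow> 'a \<Rightarrow> real"
  assumes u: "\<And>n. u n \<in> borel_measurable M" and nz: "emeasure M (space M) \<noteq> 0"
    and bdd: "\<And>y. y \<in> space M \<Longrightarrow> Bseq (\<lambda>n. u n y)"
    and K: "0 \<le> K" "\<And>n. (\<integral>\<^sup>+y. ennreal ((u n y - a n)\<^sup>2) \<partial>M) \<le> ennreal K"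
  shows "\<exists>K'\<ge>0. \<forall>n. (\<integral>\<^sup>+y. ennreal ((u n y)\<^sup>2) \<partial>M) \<le> ennreal K'"
proof -
  note [measurable] = u
  define A where "A B = {y \<in> space M. \<forall>n. \<bar>u n y\<bar> \<le> real B}" for B :: nat
  have A[measurable]: "A B \<in> sets M" for B
    unfolding A_def by measurable
  have "space M \<subseteq> (\<Union>B. A B)"
  proof
    fix y assume y: "y \<in> space M"
    obtain b where b: "\<And>n. \<bar>u n y\<bar> \<le> b"
      using bdd[OF y] by (auto simp: Bseq_def)
    have "\<bar>u n y\<bar> \<le> real (nat \<lceil>b\<rceil>)" for n using b[of n] by linarith
    then show "y \<in> (\<Union>B. A B)" using y by (auto simp: A_def)
  qed
  then have "emeasure M (\<Union>B. A B) \<noteq> 0"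
    using nz emeasure_mono[of "space M" "\<Union>B. A B" M] by auto
  then obtain B where B: "emeasure M (A B) \<noteq> 0"
    using emeasure_UN_eq_0[of M A] A by blast
  define m where "m = measure M (A B)"
  have m: "m > 0" "emeasure M (A B) = ennreal m"
    using B unfolding m_def by (auto simp: emeasure_eq_measure zero_less_measure_iff)
  define V where "V = measure M (space M)"
  have V: "emeasure M (space M) = ennreal V" "V \<ge> 0" unfolding V_def by (auto simp: emeasure_eq_measure)
  define Q where "Q = (2 * K + 2 * (real B)\<^sup>2 * V) / m"
  have Q0: "Q \<ge> 0" using m K V by (simp add: Q_def)
  \<comment> \<open>Integrate \<open>a\<^sup>2 \<le> 2 (u - a)\<^sup>2 + 2 u\<^sup>2\<close> over \<open>A B\<close>, where \<open>\<bar>u\<bar> \<le> B\<close>.\<close>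
  have a: "(a n)\<^sup>2 \<le> Q" for n
  proof -
    have "ennreal ((a n)\<^sup>2 * m) = (\<integral>\<^sup>+y. ennreal ((a n)\<^sup>2) * indicator (A B) y \<partial>M)"
      using m by (simp add: nn_integral_cmult_indicator ennreal_mult)
    also have "\<dots> \<le> (\<integral>\<^sup>+y. 2 * ennreal ((u n y - a n)\<^sup>2) + ennreal (2 * (real B)\<^sup>2) \<partial>M)"
    proof (rule nn_integral_mono)
      fix y
      show "ennreal ((a n)\<^sup>2) * indicator (A B) y \<le> 2 * ennreal ((u n y - a n)\<^sup>2) + ennreal (2 * (real B)\<^sup>2)"
      proof (cases "y \<in> A B")
        case True
        then have "(u n y)\<^sup>2 \<le> (real B)\<^sup>2"
          by (auto simp: A_def abs_le_square_iff[symmetric])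
        moreover have "(a n)\<^sup>2 \<le> 2 * (u n y - a n)\<^sup>2 + 2 * (u n y)\<^sup>2"
          using zero_le_power2[of "2 * u n y - a n"] by (simp add: power2_eq_square algebra_simps)
        ultimately have "(a n)\<^sup>2 \<le> 2 * (u n y - a n)\<^sup>2 + 2 * (real B)\<^sup>2" by linarith
        then have "ennreal ((a n)\<^sup>2) \<le> ennreal (2 * (u n y - a n)\<^sup>2 + 2 * (real B)\<^sup>2)"
          by (rule ennreal_leI)
        then show ?thesis using True by (simp add: ennreal_plus ennreal_mult)
      qed simp
    qed
    also have "\<dots> = 2 * (\<integral>\<^sup>+y. ennreal ((u n y - a n)\<^sup>2) \<partial>M) + ennreal (2 * (real B)\<^sup>2) * ennreal V"
      by (simp add: nn_integral_add nn_integral_cmult V)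
    also have "\<dots> \<le> 2 * ennreal K + ennreal (2 * (real B)\<^sup>2) * ennreal V"
      by (intro add_right_mono mult_left_mono K) auto
    also have "\<dots> = ennreal (2 * K + 2 * (real B)\<^sup>2 * V)"
      using K V by (simp add: ennreal_plus ennreal_mult)
    finally have "(a n)\<^sup>2 * m \<le> 2 * K + 2 * (real B)\<^sup>2 * V"
      using K V by (subst (asm) ennreal_le_iff) auto
    then show ?thesis using m by (simp add: Q_def field_simps)
  qed
  show ?thesis
  proof (rule exI[of _ "2 * K + 2 * Q * V"], intro conjI allI)
    show "0 \<le> 2 * K + 2 * Q * V" using K Q0 V by simp
    fix n
    have "(\<integral>\<^sup>+y. ennreal ((u n y)\<^sup>2) \<partial>M) \<le> (\<integral>\<^sup>+y. 2 * ennreal ((u n y - a n)\<^sup>2) + ennreal (2 * Q) \<partial>M)"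
    proof (rule nn_integral_mono)
      fix y
      have "(u n y)\<^sup>2 \<le> 2 * (u n y - a n)\<^sup>2 + 2 * (a n)\<^sup>2"
        using zero_le_power2[of "u n y - 2 * a n"] by (simp add: power2_eq_square algebra_simps)
      then have "(u n y)\<^sup>2 \<le> 2 * (u n y - a n)\<^sup>2 + 2 * Q" using a[of n] by linarith
      then have "ennreal ((u n y)\<^sup>2) \<le> ennreal (2 * (u n y - a n)\<^sup>2 + 2 * Q)"
        by (rule ennreal_leI)
      then show "ennreal ((u n y)\<^sup>2) \<le> 2 * ennreal ((u n y - a n)\<^sup>2) + ennreal (2 * Q)"
        using Q0 by (simp add: ennreal_plus ennreal_mult)
    qed
    also have "\<dots> = 2 * (\<integral>\<^sup>+y. ennreal ((u n y - a n)\<^sup>2) \<partial>M) + ennreal (2 * Q) * ennreal V"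
      by (simp add: nn_integral_add nn_integral_cmult V)
    also have "\<dots> \<le> 2 * ennreal K + ennreal (2 * Q) * ennreal V"
      by (intro add_right_mono mult_left_mono K) auto
    also have "\<dots> = ennreal (2 * K + 2 * Q * V)"
      using K V Q0 by (simp add: ennreal_plus ennreal_mult)
    finally show "(\<integral>\<^sup>+y. ennreal ((u n y)\<^sup>2) \<partial>M) \<le> ennreal (2 * K + 2 * Q * V)" .
  qed
qed


section \<open>Transfer to almost sure convergence and convergence in probability\<close>

text \<open>Both modes follow from one hypothesis: errors below \<open>\<delta>\<close> keep \<open>U n\<close> within \<open>\<epsilon>\<close> of \<open>c\<close>, with
  a radius \<open>\<delta>\<close> that is the same at all sample points and sample sizes, as convergence in probability
  requires. The predicate \<open>G\<close> collects side conditions that hold only almost surely.\<close>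

lemma tends_almost_surely_of_control:
  fixes U :: "nat \<Rightarrow> 'w \<Rightarrow> 'a::metric_space" and D :: "'i \<Rightarrow> nat \<Rightarrow> 'w \<Rightarrow> ennreal"
  assumes I: "finite I" and D: "\<And>i. i \<in> I \<Longrightarrow> tends_almost_surely M (D i) 0"
    and G: "AE \<omega> in M. G \<omega>"
    and control: "\<And>\<epsilon>. \<epsilon> > 0 \<Longrightarrow> \<exists>\<delta>>0. \<forall>\<omega>. G \<omega> \<longrightarrow> (\<forall>n\<ge>1. (\<forall>i\<in>I. D i n \<omega> \<le> ennreal \<delta>) \<longrightarrow> dist (U n \<omega>) c \<le> \<epsilon>)"
  shows "tends_almost_surely M U c"
proof -
  have "AE \<omega> in M. \<forall>i\<in>I. (\<lambda>n. D i n \<omega>) \<longlonglongrightarrow> 0"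
    using D by (intro AE_finite_allI[OF I]) (auto simp: tends_almost_surely_def)
  with G have "AE \<omega> in M. (\<lambda>n. U n \<omega>) \<longlonglongrightarrow> c"
  proof eventually_elim
    case (elim \<omega>)
    show ?case
    proof (rule tendstoI)
      fix e :: real assume "e > 0"
      then obtain \<delta> where \<delta>: "\<delta> > 0"
        "\<forall>n\<ge>1. (\<forall>i\<in>I. D i n \<omega> \<le> ennreal \<delta>) \<longrightarrow> dist (U n \<omega>) c \<le> e/2"
        using control[of "e/2"] elim(1) by auto
      have "eventually (\<lambda>n. \<forall>i\<in>I. D i n \<omega> < ennreal \<delta>) sequentially"
        using elim(2) \<delta>(1) by (intro eventually_ball_finite[OF I] ballI order_tendstoD) auto
      then show "eventually (\<lambda>n. dist (U n \<omega>) c < e) sequentially"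
        using eventually_ge_at_top[of 1]
      proof eventually_elim
        case (elim n)
        then have "dist (U n \<omega>) c \<le> e/2" using \<delta>(2) by (auto simp: less_imp_le)
        then show ?case using \<open>e > 0\<close> by linarith
      qed
    qed
  qed
  then show ?thesis by (simp add: tends_almost_surely_def)
qed

text \<open>Outer measure is finitely subadditive, also modulo a null set, because each set has a measurable
  hull of the same measure.\<close>

lemma outer_measure_of_UN_le:
  assumes "finite I" and A: "\<And>i. i \<in> I \<Longrightarrow> A i \<subseteq> space M"
    and N: "N \<in> null_sets M" and S: "S \<subseteq> N \<union> (\<Union>i\<in>I. A i)"
  shows "outer_measure_of M S \<le> (\<Sum>i\<in>I. outer_measure_of M (A i))"
proof -
  have "\<forall>i\<in>I. \<exists>E\<in>sets M. A i \<subseteq> E \<and> outer_measure_of M (A i) = emeasure M E"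
    using outer_measure_of_attain[OF A] by blast
  then obtain E where E: "\<And>i. i \<in> I \<Longrightarrow> E i \<in> sets M" "\<And>i. i \<in> I \<Longrightarrow> A i \<subseteq> E i"
    "\<And>i. i \<in> I \<Longrightarrow> outer_measure_of M (A i) = emeasure M (E i)" by metis
  have meas: "N \<in> sets M" "(\<Union>i\<in>I. E i) \<in> sets M" using E assms by auto
  have "outer_measure_of M S \<le> outer_measure_of M (N \<union> (\<Union>i\<in>I. E i))"
    using S E(2) by (intro outer_measure_of_mono) blast
  also have "\<dots> = emeasure M ((\<Union>i\<in>I. E i) \<union> N)"
    using meas by (simp add: Un_commute)
  also have "\<dots> = emeasure M (\<Union>i\<in>I. E i)"
    using emeasure_Un_null_set[OF meas(2) N] .
  also have "\<dots> \<le> (\<Sum>i\<in>I. emeasure M (E i))"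
    using E assms(1) by (intro emeasure_subadditive_finite) auto
  also have "\<dots> = (\<Sum>i\<in>I. outer_measure_of M (A i))" using E by simp
  finally show ?thesis .
qed

text \<open>The event that \<open>U n\<close> is far from \<open>c\<close> is covered, up to a null set, by the finitely many events
  that some \<open>D i n\<close> exceeds \<open>\<delta>\<close>.\<close>

lemma tends_in_prob_of_control:
  fixes U :: "nat \<Rightarrow> 'w \<Rightarrow> 'a::metric_space" and D :: "'i \<Rightarrow> nat \<Rightarrow> 'w \<Rightarrow> ennreal"
  assumes I: "finite I" and D: "\<And>i. i \<in> I \<Longrightarrow> vanishes_in_prob M (D i)"
    and G: "AE \<omega> in M. G \<omega>"
    and control: "\<And>\<epsilon>. \<epsilon> > 0 \<Longrightarrow> \<exists>\<delta>>0. \<forall>\<omega>. G \<omega> \<longrightarrow> (\<forall>n\<ge>1. (\<forall>i\<in>I. D i n \<omega> \<le> ennreal \<delta>) \<longrightarrow> dist (U n \<omega>) c \<le> \<epsilon>)"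
  shows "tends_in_prob M U c"
  unfolding tends_in_prob_def vanishes_in_prob_def
proof (intro allI impI)
  fix \<epsilon> :: real assume \<epsilon>: "\<epsilon> > 0"
  then obtain \<delta> where \<delta>: "\<delta> > 0"
    "\<And>\<omega> n. G \<omega> \<Longrightarrow> n \<ge> 1 \<Longrightarrow> (\<forall>i\<in>I. D i n \<omega> \<le> ennreal \<delta>) \<Longrightarrow> dist (U n \<omega>) c \<le> \<epsilon>"
    using control[of \<epsilon>] by auto
  obtain N where N: "N \<in> null_sets M" "{\<omega> \<in> space M. \<not> G \<omega>} \<subseteq> N"
    using G by (auto simp: eventually_ae_filter)
  let ?A = "\<lambda>n i. {\<omega> \<in> space M. D i n \<omega> > ennreal \<delta>}"
  let ?S = "\<lambda>n. {\<omega> \<in> space M. ennreal (dist (U n \<omega>) c) > ennreal \<epsilon>}"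
  have lim: "(\<lambda>n. \<Sum>i\<in>I. outer_measure_of M (?A n i)) \<longlonglongrightarrow> (\<Sum>i\<in>I. 0)"
    using D \<delta>(1) by (intro tendsto_sum) (auto simp: vanishes_in_prob_def)
  have le: "outer_measure_of M (?S n) \<le> (\<Sum>i\<in>I. outer_measure_of M (?A n i))" if "n \<ge> 1" for n
  proof (rule outer_measure_of_UN_le[OF I _ N(1)])
    show "?S n \<subseteq> N \<union> (\<Union>i\<in>I. ?A n i)"
    proof
      fix \<omega> assume w: "\<omega> \<in> ?S n"
      then have "\<not> dist (U n \<omega>) c \<le> \<epsilon>" using \<epsilon> by (auto simp: ennreal_less_iff)
      then have "\<not> G \<omega> \<or> (\<exists>i\<in>I. \<not> D i n \<omega> \<le> ennreal \<delta>)" using \<delta>(2) that by blast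
      then show "\<omega> \<in> N \<union> (\<Union>i\<in>I. ?A n i)" using w N(2) by (auto simp: not_le)
    qed
  qed auto
  show "(\<lambda>n. outer_measure_of M (?S n)) \<longlonglongrightarrow> 0"
    by (rule tendsto_sandwich[OF _ _ tendsto_const[of 0] lim[simplified]])
       (auto intro!: eventually_sequentiallyI[of 1] le)
qed


section \<open>Continuity of the expected loss\<close>

lemma set_integral_bounds_of_continuous:
  fixes g :: "'a::euclidean_space \<Rightarrow> real"
  assumes S: "compact S" and g: "continuous_on S g"
    and bnd: "\<And>y. y \<in> S \<Longrightarrow> a \<le> g y" "\<And>y. y \<in> S \<Longrightarrow> g y \<le> b"
  shows "a * measure lborel S \<le> (LINT y:S|lborel. g y)"
    and "(LINT y:S|lborel. g y) \<le> b * measure lborel S"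
proof -
  have int: "set_integrable lborel S g"
    unfolding set_integrable_def using S g by (rule borel_integrable_compact)
  have const: "set_integrable lborel S (\<lambda>_. r)" "(LINT y:S|lborel. r) = r * measure lborel S" for r :: real
    unfolding set_integrable_def set_lebesgue_integral_def
    using borel_integrable_compact[OF S continuous_on_const, of r] S
    by (auto simp: compact_imp_closed emeasure_compact_finite)
  show "a * measure lborel S \<le> (LINT y:S|lborel. g y)"
    using set_integral_mono[OF const(1)[of a] int] bnd(1) const(2)[of a] by simp
  show "(LINT y:S|lborel. g y) \<le> b * measure lborel S"
    using set_integral_mono[OF int const(1)[of b]] bnd(2) const(2)[of b] by simp
qed

lemma twice_cont_differentiable_on_imp_continuous_on:
  "twice_cont_differentiable_on S h \<Longrightarrow> continuous_on S h"
  unfolding twice_cont_differentiable_on_def continuous_on_eq_continuous_within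
  by (blast intro: has_derivative_continuous)

text \<open>If a factor were null, a probability measure would have a density supported in a null set. Positive
  volumes matter because the conditional laws divide by integrals over \<open>Z2\<close> and \<open>Y\<close>.\<close>

lemma positive_volume_of_joint_density:
  fixes Z :: "'z::euclidean_space set" and X :: "'x::euclidean_space set" and Y :: "'y::euclidean_space set"
  assumes "prob_space M" and T: "distributed M lborel T (joint_density (Z \<times> X \<times> Y) f)"
    and "compact Z" "compact X" "compact Y"
  shows "emeasure lborel Z \<noteq> 0" and "emeasure lborel Y \<noteq> 0"
proof -
  interpret prob_space M by fact
  have "Z \<times> X \<times> Y \<notin> null_sets lborel"
  proof
    assume "Z \<times> X \<times> Y \<in> null_sets lborel"
    then have "AE p in lborel. joint_density (Z \<times> X \<times> Y) f p = 0"
      by (rule eventually_mono[OF AE_not_in]) (simp add: joint_density_def)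
    then have "(\<integral>\<^sup>+p. joint_density (Z \<times> X \<times> Y) f p * indicator UNIV p \<partial>lborel) = 0"
      by (subst nn_integral_0_iff_AE) (use distributed_borel_measurable[OF T] in auto)
    then have "emeasure M (T -` UNIV \<inter> space M) = 0"
      using distributed_emeasure[OF T, of UNIV] by simp
    then show False by (simp add: emeasure_space_1)
  qed
  moreover have "emeasure lborel (Z \<times> X \<times> Y) = emeasure lborel Z * (emeasure lborel X * emeasure lborel Y)"
  proof -
    have sets: "Z \<in> sets lborel" "X \<in> sets lborel" "Y \<in> sets lborel"
      using assms by (auto intro: borel_closed compact_imp_closed)
    then have XY: "X \<times> Y \<in> sets (lborel :: ('x \<times> 'y) measure)"
      unfolding lborel_prod[symmetric] by (intro pair_measureI)
    have "emeasure lborel (X \<times> Y) = emeasure lborel X * emeasure lborel Y"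
      using lborel.emeasure_pair_measure_Times[OF sets(2,3)] unfolding lborel_prod .
    moreover have "emeasure lborel (Z \<times> X \<times> Y) = emeasure lborel Z * emeasure lborel (X \<times> Y)"
      using lborel.emeasure_pair_measure_Times[OF sets(1) XY] unfolding lborel_prod .
    ultimately show ?thesis by simp
  qed
  moreover have "Z \<times> X \<times> Y \<in> sets lborel"
    using assms by (simp add: compact_Times compact_imp_closed)
  ultimately show "emeasure lborel Z \<noteq> 0" "emeasure lborel Y \<noteq> 0"
    by (auto simp: null_sets_def)
qed

text \<open>The properties of the joint density under which conditional densities are bounded above and below
  by positive constants and the expected loss is continuous in the decision.\<close>

locale bounded_joint_density =
  fixes Z1 :: "'a::euclidean_space set" and Z2 :: "'b::euclidean_space set"
    and X :: "'x::euclidean_space set" and Y :: "'y::euclidean_space set"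
    and f :: "('a \<times> 'b) \<times> 'x \<times> 'y \<Rightarrow> real" and c C :: real
  assumes compact_Z2: "compact Z2" and compact_Y: "compact Y"
    and vol_Z2: "measure lborel Z2 > 0" and vol_Y: "measure lborel Y > 0"
    and cont: "continuous_on ((Z1 \<times> Z2) \<times> X \<times> Y) f"
    and c_pos: "c > 0" and bounds: "\<And>p. p \<in> (Z1 \<times> Z2) \<times> X \<times> Y \<Longrightarrow> c \<le> f p \<and> f p \<le> C"
    and cont_marginal: "continuous_on ((Z1 \<times> Z2) \<times> X) (\<lambda>(z, x). marginal_zx Y f z x)"
begin

definition leb_Y :: "'y measure" where "leb_Y = restrict_space lborel Y"

lemma Y_sets[simp]: "Y \<in> sets borel"
  using compact_Y by (auto intro: borel_closed compact_imp_closed)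

lemma space_leb_Y[simp]: "space leb_Y = Y"
  by (simp add: leb_Y_def space_restrict_space)

lemma sets_leb_Y[measurable_cong]: "sets leb_Y = sets (restrict_space borel Y)"
  by (simp add: leb_Y_def sets_restrict_space)

lemma emeasure_leb_Y: "emeasure leb_Y (space leb_Y) = ennreal (measure lborel Y)"
  unfolding space_leb_Y unfolding leb_Y_def
  using emeasure_compact_finite[OF compact_Y]
  by (subst emeasure_restrict_space) (auto simp: emeasure_eq_ennreal_measure)

sublocale leb_Y: finite_measure leb_Y
  by (rule finite_measureI) (simp only: emeasure_leb_Y, simp)

lemma borel_measurable_leb_Y_continuous: "continuous_on Y g \<Longrightarrow> g \<in> borel_measurable leb_Y"
  using borel_measurable_continuous_on_restrict measurable_cong_sets[OF sets_leb_Y refl] by blast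

lemma marginal_bounds:
  assumes "z \<in> Z1 \<times> Z2" "x \<in> X"
  shows "c * measure lborel Y \<le> marginal_zx Y f z x" "marginal_zx Y f z x \<le> C * measure lborel Y"
proof -
  have "continuous_on Y (\<lambda>y. f (z, x, y))"
    using assms by (intro continuous_on_compose2[OF cont] continuous_intros) auto
  from set_integral_bounds_of_continuous[OF compact_Y this, of c C]
  show "c * measure lborel Y \<le> marginal_zx Y f z x" "marginal_zx Y f z x \<le> C * measure lborel Y"
    unfolding marginal_zx_def using assms bounds by auto
qed

lemma marginal_pos: "z \<in> Z1 \<times> Z2 \<Longrightarrow> x \<in> X \<Longrightarrow> marginal_zx Y f z x > 0"
  using marginal_bounds(1)[of z x] c_pos vol_Y by (smt (verit) mult_pos_pos)

lemma cond_density_bounds: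
  assumes "z \<in> Z1 \<times> Z2" "x \<in> X" "y \<in> Y"
  shows "0 \<le> cond_density Y f z x y" "cond_density Y f z x y \<le> C / (c * measure lborel Y)"
proof -
  have f: "c \<le> f (z, x, y)" "f (z, x, y) \<le> C" using bounds assms by auto
  show "0 \<le> cond_density Y f z x y"
    using f c_pos marginal_pos[OF assms(1,2)] by (simp add: cond_density_def)
  show "cond_density Y f z x y \<le> C / (c * measure lborel Y)"
    unfolding cond_density_def
    using f marginal_bounds(1)[OF assms(1,2)] c_pos vol_Y by (intro frac_le) auto
qed

lemma cond_density_measurable:
  assumes "z \<in> Z1 \<times> Z2" "x \<in> X"
  shows "cond_density Y f z x \<in> borel_measurable leb_Y"
proof -
  have "continuous_on Y (\<lambda>y. f (z, x, y))"
    using assms by (intro continuous_on_compose2[OF cont] continuous_intros) auto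
  then show ?thesis
    unfolding cond_density_def by (intro borel_measurable_leb_Y_continuous continuous_intros)
       (use marginal_pos[OF assms] in auto)
qed

lemma exp_loss_eq:
  assumes "z \<in> Z1 \<times> Z2" "x \<in> X" "l z \<in> borel_measurable leb_Y"
  shows "exp_loss Y f l z x = (\<integral>y. cond_density Y f z x y * l z y \<partial>leb_Y)"
  unfolding exp_loss_def cond_law_def leb_Y_def[symmetric]
  using assms cond_density_measurable[OF assms(1,2)] cond_density_bounds(1)[OF assms(1,2)]
  by (subst integral_density) auto

text \<open>The density in the definition of \<^const>\<open>cond_law_fst\<close>.\<close>

definition density_fst :: "'a \<Rightarrow> 'x \<Rightarrow> 'y \<Rightarrow> real" where
  "density_fst z1 x y =
     (LINT z2:Z2|lborel. f ((z1, z2), x, y)) / (LINT z2:Z2|lborel. marginal_zx Y f (z1, z2) x)"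

lemma density_fst_ge:
  assumes "z1 \<in> Z1" "x \<in> X" "y \<in> Y"
  shows "density_fst z1 x y \<ge> c / (C * measure lborel Y)"
proof -
  have "continuous_on Z2 (\<lambda>z2. f ((z1, z2), x, y))"
    using assms by (intro continuous_on_compose2[OF cont] continuous_intros) auto
  from set_integral_bounds_of_continuous(1)[OF compact_Z2 this, of c C]
  have num: "c * measure lborel Z2 \<le> (LINT z2:Z2|lborel. f ((z1, z2), x, y))"
    using assms bounds by auto
  have "continuous_on Z2 (\<lambda>z2. (\<lambda>(z, x). marginal_zx Y f z x) ((z1, z2), x))"
    using assms by (intro continuous_on_compose2[OF cont_marginal] continuous_intros) auto
  then have "continuous_on Z2 (\<lambda>z2. marginal_zx Y f (z1, z2) x)" by simp
  note den = set_integral_bounds_of_continuous[OF compact_Z2 this,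
    of "c * measure lborel Y" "C * measure lborel Y"]
  have den1: "c * measure lborel Y * measure lborel Z2 \<le> (LINT z2:Z2|lborel. marginal_zx Y f (z1, z2) x)"
    and den2: "(LINT z2:Z2|lborel. marginal_zx Y f (z1, z2) x) \<le> C * measure lborel Y * measure lborel Z2"
    using den marginal_bounds assms by auto
  have "0 < c * measure lborel Y * measure lborel Z2"
    using c_pos vol_Y vol_Z2 by simp
  moreover have "0 < c * measure lborel Z2"
    using c_pos vol_Z2 by simp
  ultimately have "(c * measure lborel Z2) / (C * measure lborel Y * measure lborel Z2) \<le> density_fst z1 x y"
    unfolding density_fst_def using num den1 den2 by (intro frac_le) linarith+
  then show ?thesis using vol_Z2 by simp
qed

text \<open>The joint density is measurable only as a function on \<open>Y \<times> Z2\<close>; cutting it off outside this compact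
  set makes it Borel on the whole space, where Fubini's theorem gives measurability of the integral
  over \<open>z2\<close>.\<close>

lemma density_fst_measurable:
  assumes "z1 \<in> Z1" "x \<in> X"
  shows "density_fst z1 x \<in> borel_measurable leb_Y"
proof -
  let ?h = "\<lambda>p :: 'y \<times> 'b. indicator (Y \<times> Z2) p *\<^sub>R f ((z1, snd p), x, fst p)"
  have "continuous_on (Y \<times> Z2) (\<lambda>p. f ((z1, snd p), x, fst p))"
    using assms by (intro continuous_on_compose2[OF cont] continuous_intros) auto
  then have h: "?h \<in> borel_measurable borel"
    using compact_Y compact_Z2
    by (intro borel_measurable_continuous_on_indicator borel_closed compact_imp_closed compact_Times)
  have sets_prod: "sets (borel \<Otimes>\<^sub>M lborel :: ('y \<times> 'b) measure) = sets borel"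
    unfolding borel_prod[symmetric] by (intro sets_pair_measure_cong sets_lborel refl)
  have "?h \<in> borel_measurable (borel \<Otimes>\<^sub>M lborel)"
    by (subst measurable_cong_sets[OF sets_prod refl]) (rule h)
  then have "(\<lambda>(y, z2). ?h (y, z2)) \<in> borel_measurable (borel \<Otimes>\<^sub>M lborel)"
    by (simp add: split_beta')
  then have "(\<lambda>y. \<integral>z2. ?h (y, z2) \<partial>lborel) \<in> borel_measurable borel"
    by (rule lborel.borel_measurable_lebesgue_integral)
  then have "(\<lambda>y. \<integral>z2. ?h (y, z2) \<partial>lborel) \<in> borel_measurable leb_Y"
    using measurable_restrict_space1 measurable_cong_sets[OF sets_leb_Y refl] by blast
  also have "?this \<longleftrightarrow> (\<lambda>y. LINT z2:Z2|lborel. f ((z1, z2), x, y)) \<in> borel_measurable leb_Y"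
    unfolding set_lebesgue_integral_def
    by (intro measurable_cong Bochner_Integration.integral_cong) (auto simp: indicator_def)
  finally show ?thesis unfolding density_fst_def by measurable
qed

text \<open>The quadratic term of the exponential series bounds second moments by exponential moments, and the
  lower bound on the density replaces the conditional law by Lebesgue measure. The reference measure thus
  no longer depends on the decision. The centre varies with the decision and the
  context, the bound does not.\<close>

lemma bounded_tails_imp_second_moments:
  assumes tails: "bounded_tails Z1 Z2 X Y f l"
    and l: "\<And>z. z \<in> Z1 \<times> Z2 \<Longrightarrow> l z \<in> borel_measurable leb_Y"
  shows "\<exists>K\<ge>0. \<forall>z\<in>Z1 \<times> Z2. \<forall>x\<in>X. \<exists>a. (\<integral>\<^sup>+y. ennreal ((l z y - a)\<^sup>2) \<partial>leb_Y) \<le> ennreal K"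
proof -
  define E where "E r z x = (\<integral>\<^sup>+y. ennreal (exp (r * \<bar>l z y - (\<integral>y'. l z y' \<partial>cond_law_fst Z2 Y f (fst z) x)\<bar>))
           \<partial>cond_law_fst Z2 Y f (fst z) x)" for r z x
  obtain r where r: "r > 0" and fin: "(SUP (z, x)\<in>(Z1 \<times> Z2) \<times> X. E r z x) < \<infinity>"
    using tails unfolding bounded_tails_def E_def by blast
  define S where "S = enn2real (SUP (z, x)\<in>(Z1 \<times> Z2) \<times> X. E r z x)"
  have S: "(SUP (z, x)\<in>(Z1 \<times> Z2) \<times> X. E r z x) = ennreal S"
    unfolding S_def using fin by simp
  define \<kappa> where "\<kappa> = c / (C * measure lborel Y) * (r\<^sup>2 / 2)"
  show ?thesis
  proof (rule exI[of _ "max 0 (S / \<kappa>)"], intro conjI ballI)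
    show "0 \<le> max 0 (S / \<kappa>)" by simp
    fix z x assume z: "z \<in> Z1 \<times> Z2" and x: "x \<in> X"
    then have z1: "fst z \<in> Z1" by auto
    have "C * measure lborel Y > 0"
      using marginal_pos[OF z x] marginal_bounds(2)[OF z x] by linarith
    then have \<kappa>: "\<kappa> > 0" "c / (C * measure lborel Y) > 0"
      using c_pos r by (auto simp: \<kappa>_def)
    define a where "a = (\<integral>y'. l z y' \<partial>cond_law_fst Z2 Y f (fst z) x)"
    note [measurable] = l[OF z] density_fst_measurable[OF z1 x]
    have "ennreal \<kappa> * (\<integral>\<^sup>+y. ennreal ((l z y - a)\<^sup>2) \<partial>leb_Y) = (\<integral>\<^sup>+y. ennreal \<kappa> * ennreal ((l z y - a)\<^sup>2) \<partial>leb_Y)"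
      by (rule nn_integral_cmult[symmetric]) measurable
    also have "\<dots> \<le> (\<integral>\<^sup>+y. ennreal (density_fst (fst z) x y) * ennreal (exp (r * \<bar>l z y - a\<bar>)) \<partial>leb_Y)"
    proof (rule nn_integral_mono)
      fix y assume "y \<in> space leb_Y"
      then have ge: "c / (C * measure lborel Y) \<le> density_fst (fst z) x y"
        using density_fst_ge[OF z1 x] by simp
      have "(r * \<bar>l z y - a\<bar>)\<^sup>2 / 2 \<le> exp (r * \<bar>l z y - a\<bar>)"
        using exp_lower_Taylor_quadratic[of "r * \<bar>l z y - a\<bar>"] r
        by (smt (verit) mult_nonneg_nonneg)
      then have "r\<^sup>2 / 2 * (l z y - a)\<^sup>2 \<le> exp (r * \<bar>l z y - a\<bar>)"
        by (simp add: power_mult_distrib)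
      then have "c / (C * measure lborel Y) * (r\<^sup>2 / 2 * (l z y - a)\<^sup>2) \<le> density_fst (fst z) x y * exp (r * \<bar>l z y - a\<bar>)"
        using ge \<kappa> by (intro mult_mono) auto
      then have "\<kappa> * (l z y - a)\<^sup>2 \<le> density_fst (fst z) x y * exp (r * \<bar>l z y - a\<bar>)"
        by (simp add: \<kappa>_def mult.assoc)
      then show "ennreal \<kappa> * ennreal ((l z y - a)\<^sup>2) \<le> ennreal (density_fst (fst z) x y) * ennreal (exp (r * \<bar>l z y - a\<bar>))"
        using \<kappa> ge by (simp add: ennreal_mult[symmetric] ennreal_leI)
    qed
    also have "\<dots> = (\<integral>\<^sup>+y. ennreal (exp (r * \<bar>l z y - a\<bar>)) \<partial>density leb_Y (\<lambda>y. ennreal (density_fst (fst z) x y)))"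
      by (rule nn_integral_density[symmetric]) measurable
    also have "\<dots> = E r z x"
      by (simp add: E_def a_def cond_law_fst_def leb_Y_def density_fst_def)
    also have "\<dots> \<le> (SUP (z, x)\<in>(Z1 \<times> Z2) \<times> X. E r z x)"
      using z x by (intro SUP_upper2[of "(z, x)"]) auto
    finally have "ennreal \<kappa> * (\<integral>\<^sup>+y. ennreal ((l z y - a)\<^sup>2) \<partial>leb_Y) \<le> ennreal S"
      unfolding S .
    then have "ennreal (1 / \<kappa>) * (ennreal \<kappa> * (\<integral>\<^sup>+y. ennreal ((l z y - a)\<^sup>2) \<partial>leb_Y)) \<le> ennreal (1 / \<kappa>) * ennreal S"
      by (rule mult_left_mono) simp
    then have "(\<integral>\<^sup>+y. ennreal ((l z y - a)\<^sup>2) \<partial>leb_Y) \<le> ennreal (S / \<kappa>)"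
      using \<kappa> by (simp add: mult.assoc[symmetric] ennreal_mult'[symmetric])
    also have "\<dots> \<le> ennreal (max 0 (S / \<kappa>))" by (intro ennreal_leI) simp
    finally show "\<exists>a. (\<integral>\<^sup>+y. ennreal ((l z y - a)\<^sup>2) \<partial>leb_Y) \<le> ennreal (max 0 (S / \<kappa>))" by blast
  qed
qed


text \<open>Along a convergent sequence of decisions the integrands, conditional density times loss, converge
  for each outcome. Their second moments are bounded because the densities are bounded and the second
  moments of the losses are, so the integrals converge.\<close>

lemma continuous_on_exp_loss:
  assumes tails: "bounded_tails Z1 Z2 X Y f l"
    and l: "\<And>z. z \<in> Z1 \<times> Z2 \<Longrightarrow> l z \<in> borel_measurable leb_Y"
    and equi: "equicontinuous_in_decision (Z1 \<times> Z2) Y l"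
    and x: "x \<in> X"
  shows "continuous_on (Z1 \<times> Z2) (\<lambda>z. exp_loss Y f l z x)"
proof (rule continuous_on_sequentiallyI)
  fix s :: "nat \<Rightarrow> 'a \<times> 'b" and z
  assume s: "\<forall>n. s n \<in> Z1 \<times> Z2" and z: "z \<in> Z1 \<times> Z2" and lim: "s \<longlonglongrightarrow> z"
  have l_lim: "(\<lambda>n. l (s n) y) \<longlonglongrightarrow> l z y" if y: "y \<in> Y" for y
  proof (rule LIMSEQ_I)
    fix e :: real assume e: "0 < e"
    then obtain \<delta> where \<delta>: "\<delta> > 0" "\<forall>z'\<in>Z1 \<times> Z2. norm (z - z') \<le> \<delta> \<longrightarrow> \<bar>l z y - l z' y\<bar> \<le> e / 2"
      using equi[unfolded equicontinuous_in_decision_def, rule_format, OF z y, of "e / 2"] by auto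
    obtain n0 where "\<And>n. n \<ge> n0 \<Longrightarrow> norm (s n - z) < \<delta>"
      using LIMSEQ_D[OF lim \<delta>(1)] by blast
    then have "norm (l (s n) y - l z y) < e" if "n \<ge> n0" for n
    proof -
      have "norm (z - s n) \<le> \<delta>"
        using \<open>\<And>n. n \<ge> n0 \<Longrightarrow> norm (s n - z) < \<delta>\<close>[OF that] by (simp add: norm_minus_commute)
      then have "\<bar>l z y - l (s n) y\<bar> \<le> e / 2" using \<delta>(2) s by blast
      then show ?thesis using e unfolding real_norm_def by linarith
    qed
    then show "\<exists>n0. \<forall>n\<ge>n0. norm (l (s n) y - l z y) < e" by blast
  qed
  have p_lim: "(\<lambda>n. cond_density Y f (s n) x y) \<longlonglongrightarrow> cond_density Y f z x y" if y: "y \<in> Y" for y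
  proof -
    have "(\<lambda>n. f (s n, x, y)) \<longlonglongrightarrow> f (z, x, y)"
    proof (rule continuous_on_tendsto_compose[OF cont])
      show "(\<lambda>n. (s n, x, y)) \<longlonglongrightarrow> (z, x, y)" by (intro tendsto_Pair lim tendsto_const)
      show "\<forall>\<^sub>F n in sequentially. (s n, x, y) \<in> (Z1 \<times> Z2) \<times> X \<times> Y"
        using s x y by (intro always_eventually allI SigmaI) blast+
    qed (use z x y in blast)
    moreover have "(\<lambda>n. marginal_zx Y f (s n) x) \<longlonglongrightarrow> marginal_zx Y f z x"
    proof -
      have "(\<lambda>n. (\<lambda>(z, x). marginal_zx Y f z x) (s n, x)) \<longlonglongrightarrow> (\<lambda>(z, x). marginal_zx Y f z x) (z, x)"
      proof (rule continuous_on_tendsto_compose[OF cont_marginal])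
        show "(\<lambda>n. (s n, x)) \<longlonglongrightarrow> (z, x)" by (intro tendsto_Pair lim tendsto_const)
        show "\<forall>\<^sub>F n in sequentially. (s n, x) \<in> (Z1 \<times> Z2) \<times> X"
          using s x by (intro always_eventually allI SigmaI) blast+
      qed (use z x in blast)
      then show ?thesis by simp
    qed
    ultimately show ?thesis
      unfolding cond_density_def using marginal_pos[OF z x] by (intro tendsto_divide) simp_all
  qed
  obtain K where K: "0 \<le> K"
    "\<forall>z\<in>Z1 \<times> Z2. \<forall>x\<in>X. \<exists>a. (\<integral>\<^sup>+y. ennreal ((l z y - a)\<^sup>2) \<partial>leb_Y) \<le> ennreal K"
    using bounded_tails_imp_second_moments[OF tails l] by blast
  then have "\<forall>n. \<exists>a. (\<integral>\<^sup>+y. ennreal ((l (s n) y - a)\<^sup>2) \<partial>leb_Y) \<le> ennreal K"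
    using s x by blast
  then obtain a where a: "\<And>n. (\<integral>\<^sup>+y. ennreal ((l (s n) y - a n)\<^sup>2) \<partial>leb_Y) \<le> ennreal K"
    by metis
  have Bs: "Bseq (\<lambda>n. l (s n) y)" if "y \<in> space leb_Y" for y
    using convergent_imp_Bseq[OF convergentI[OF l_lim]] that by simp
  have l_meas: "l (s n) \<in> borel_measurable leb_Y" for n
    using l s by blast
  have nz: "emeasure leb_Y (space leb_Y) \<noteq> 0"
    using vol_Y by (simp only: emeasure_leb_Y) simp
  obtain K' where K': "0 \<le> K'" "\<And>n. (\<integral>\<^sup>+y. ennreal ((l (s n) y)\<^sup>2) \<partial>leb_Y) \<le> ennreal K'"
    using leb_Y.second_moments_bounded_of_centred[OF l_meas nz Bs K(1) a] by blast
  define B where "B = C / (c * measure lborel Y)"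
  have "(\<lambda>n. \<integral>y. cond_density Y f (s n) x y * l (s n) y \<partial>leb_Y)
    \<longlonglongrightarrow> (\<integral>y. cond_density Y f z x y * l z y \<partial>leb_Y)"
  proof (rule leb_Y.integral_tendsto_of_bounded_second_moments)
    show "(\<lambda>y. cond_density Y f (s n) x y * l (s n) y) \<in> borel_measurable leb_Y" for n
      using s x by (intro borel_measurable_times cond_density_measurable l) auto
    show "(\<lambda>y. cond_density Y f z x y * l z y) \<in> borel_measurable leb_Y"
      using z x by (intro borel_measurable_times cond_density_measurable l) auto
    show "(\<lambda>n. cond_density Y f (s n) x y * l (s n) y) \<longlonglongrightarrow> cond_density Y f z x y * l z y"
      if "y \<in> space leb_Y" for y
      using that by (intro tendsto_mult p_lim l_lim) auto
    show "0 \<le> B\<^sup>2 * K'" using K'(1) by simp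
    fix n
    have sn: "s n \<in> Z1 \<times> Z2" using s by blast
    note [measurable] = l[OF sn]
    have "(\<integral>\<^sup>+y. ennreal ((cond_density Y f (s n) x y * l (s n) y)\<^sup>2) \<partial>leb_Y)
      \<le> (\<integral>\<^sup>+y. ennreal (B\<^sup>2) * ennreal ((l (s n) y)\<^sup>2) \<partial>leb_Y)"
    proof (rule nn_integral_mono)
      fix y assume "y \<in> space leb_Y"
      then have "(cond_density Y f (s n) x y)\<^sup>2 \<le> B\<^sup>2"
        using cond_density_bounds[OF sn x, of y] unfolding B_def by (intro power_mono) auto
      then have "(cond_density Y f (s n) x y * l (s n) y)\<^sup>2 \<le> B\<^sup>2 * (l (s n) y)\<^sup>2"
        by (simp add: power_mult_distrib mult_right_mono)
      then show "ennreal ((cond_density Y f (s n) x y * l (s n) y)\<^sup>2) \<le> ennreal (B\<^sup>2) * ennreal ((l (s n) y)\<^sup>2)"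
        by (simp add: ennreal_mult[symmetric] ennreal_leI)
    qed
    also have "\<dots> = ennreal (B\<^sup>2) * (\<integral>\<^sup>+y. ennreal ((l (s n) y)\<^sup>2) \<partial>leb_Y)"
      by (rule nn_integral_cmult) measurable
    also have "\<dots> \<le> ennreal (B\<^sup>2) * ennreal K'"
      by (intro mult_left_mono K') simp
    also have "\<dots> = ennreal (B\<^sup>2 * K')"
      using K'(1) by (simp add: ennreal_mult)
    finally show "(\<integral>\<^sup>+y. ennreal ((cond_density Y f (s n) x y * l (s n) y)\<^sup>2) \<partial>leb_Y) \<le> ennreal (B\<^sup>2 * K')" .
  qed
  then show "(\<lambda>n. exp_loss Y f l (s n) x) \<longlonglongrightarrow> exp_loss Y f l z x"
    using s z x l by (simp add: exp_loss_eq)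
qed

end


section \<open>The closest point of the estimated feasible set\<close>

lemma sup_dev_leD:
  assumes "sup_dev Z u v \<le> ennreal \<delta>" "0 \<le> \<delta>" "z \<in> Z"
  shows "\<bar>u z - v z\<bar> \<le> \<delta>"
proof -
  have "ennreal \<bar>u z - v z\<bar> \<le> sup_dev Z u v"
    unfolding sup_dev_def using assms(3) by (rule SUP_upper)
  also note assms(1)
  finally show ?thesis using assms(2) by simp
qed

text \<open>The constraints are numbered from 1, so index 0 is free for the loss. As one finite family the
  errors can be made small simultaneously.\<close>

definition deviation ::
  "'z set \<Rightarrow> 'y::euclidean_space set \<Rightarrow> ('z \<times> 'x \<times> 'y \<Rightarrow> real) \<Rightarrow> ('z \<Rightarrow> 'y \<Rightarrow> real) \<Rightarrow>
   (nat \<Rightarrow> 'z \<Rightarrow> 'y \<Rightarrow> real) \<Rightarrow> ('w \<Rightarrow> nat \<Rightarrow> nat \<Rightarrow> 'z \<Rightarrow> 'x \<Rightarrow> real) \<Rightarrow>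
   (nat \<Rightarrow> 'w \<Rightarrow> 'y) \<Rightarrow> 'x \<Rightarrow> nat \<Rightarrow> nat \<Rightarrow> 'w \<Rightarrow> ennreal" where
  "deviation Z Y f l \<psi> W ys x i n \<omega> =
     (if i = 0 then sup_dev Z (\<lambda>z. exp_loss Y f l z x) (\<lambda>z. est_loss W ys l n \<omega> z x)
      else sup_dev Z (\<lambda>z. sat_prob Y f (\<psi> i) z x) (\<lambda>z. est_prob W ys (\<psi> i) n \<omega> z x))"

text \<open>A uniform error that does not exceed the smallest margin by which \<open>z\<close> satisfies the true
  constraints cannot make it violate an estimated one.\<close>

lemma strictly_feasible_imp_est_feasible:
  assumes z: "z \<in> Z" and strict: "\<forall>\<xi>\<in>{1..\<Xi>}. sat_prob Y f (\<psi> \<xi>) z x > 1 - \<alpha> \<xi>"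
  shows "\<exists>\<delta>>0. \<forall>\<omega> n. (\<forall>i\<in>{0..\<Xi>}. deviation Z Y f l \<psi> W ys x i n \<omega> \<le> ennreal \<delta>) \<longrightarrow>
           z \<in> est_feasible Z \<Xi> \<alpha> \<psi> W ys n \<omega> x"
proof -
  \<comment> \<open>The element 1 keeps the set nonempty if there are no constraints.\<close>
  define \<delta> where "\<delta> = Min (insert 1 ((\<lambda>\<xi>. sat_prob Y f (\<psi> \<xi>) z x - (1 - \<alpha> \<xi>)) ` {1..\<Xi>}))"
  have pos: "\<delta> > 0"
    unfolding \<delta>_def using strict by (subst Min_gr_iff) auto
  have le: "\<delta> \<le> sat_prob Y f (\<psi> \<xi>) z x - (1 - \<alpha> \<xi>)" if "\<xi> \<in> {1..\<Xi>}" for \<xi>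
    unfolding \<delta>_def using that by (intro Min_le) auto
  show ?thesis
  proof (intro exI[of _ \<delta>] conjI allI impI pos)
    fix \<omega> n assume D: "\<forall>i\<in>{0..\<Xi>}. deviation Z Y f l \<psi> W ys x i n \<omega> \<le> ennreal \<delta>"
    have "est_prob W ys (\<psi> \<xi>) n \<omega> z x \<ge> 1 - \<alpha> \<xi>" if \<xi>: "\<xi> \<in> {1..\<Xi>}" for \<xi>
    proof -
      have "sup_dev Z (\<lambda>z. sat_prob Y f (\<psi> \<xi>) z x) (\<lambda>z. est_prob W ys (\<psi> \<xi>) n \<omega> z x) \<le> ennreal \<delta>"
        using D[rule_format, of \<xi>] \<xi> by (simp add: deviation_def)
      from sup_dev_leD[OF this _ z] pos le[OF \<xi>] show ?thesis by linarith
    qed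
    then show "z \<in> est_feasible Z \<Xi> \<alpha> \<psi> W ys n \<omega> x"
      using z by (simp add: est_feasible_def)
  qed
qed

text \<open>The deterministic core. A strictly feasible decision within \<open>\<epsilon>\<close> of \<open>z_opt\<close> becomes feasible for the
  estimated problem, so the closest estimated feasible point is within \<open>\<epsilon>\<close> as well; continuity of the
  true loss and the uniform error of the estimated loss give the other two claims.\<close>

lemma closest_est_feasible_control:
  fixes Z :: "'z::euclidean_space set" and ys :: "nat \<Rightarrow> 'w \<Rightarrow> 'y::euclidean_space"
    and W :: "'w \<Rightarrow> nat \<Rightarrow> nat \<Rightarrow> 'z \<Rightarrow> 'x \<Rightarrow> real"
  assumes slater: "\<forall>\<epsilon>>0. \<exists>z\<in>Z. norm (z - z_opt) \<le> \<epsilon> \<and>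
      (\<forall>\<xi>\<in>{1..\<Xi>}. sat_prob Y f (\<psi> \<xi>) z x > 1 - \<alpha> \<xi>)"
    and "z_opt \<in> Z" and cont: "continuous_on Z (\<lambda>z. exp_loss Y f l z x)" and "\<epsilon> > 0"
  defines "F n \<omega> \<equiv> est_feasible Z \<Xi> \<alpha> \<psi> W ys n \<omega> x"
  defines "zn n \<omega> \<equiv> closest_point (F n \<omega>) z_opt"
  defines "G \<omega> \<equiv> \<forall>n\<ge>1. F n \<omega> \<noteq> {} \<and> compact (F n \<omega>)"
  defines "small \<delta> n \<omega> \<equiv> \<forall>i\<in>{0..\<Xi>}. deviation Z Y f l \<psi> W ys x i n \<omega> \<le> ennreal \<delta>"
  shows "\<exists>\<delta>>0. \<forall>\<omega>. G \<omega> \<longrightarrow> (\<forall>n\<ge>1. small \<delta> n \<omega> \<longrightarrow> dist (zn n \<omega>) z_opt \<le> \<epsilon>)"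
    and "\<exists>\<delta>>0. \<forall>\<omega>. G \<omega> \<longrightarrow> (\<forall>n\<ge>1. small \<delta> n \<omega> \<longrightarrow>
          dist (exp_loss Y f l (zn n \<omega>) x) (exp_loss Y f l z_opt x) \<le> \<epsilon>)"
    and "\<exists>\<delta>>0. \<forall>\<omega>. G \<omega> \<longrightarrow> (\<forall>n\<ge>1. small \<delta> n \<omega> \<longrightarrow>
          dist (est_loss W ys l n \<omega> (zn n \<omega>) x) (exp_loss Y f l z_opt x) \<le> \<epsilon>)"
proof -
  have znF: "zn n \<omega> \<in> F n \<omega>" and znZ: "zn n \<omega> \<in> Z"
    and closest: "z \<in> F n \<omega> \<Longrightarrow> dist z_opt (zn n \<omega>) \<le> dist z_opt z"
    if "G \<omega>" "n \<ge> 1" for n \<omega> z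
    using that closest_point_exists[of "F n \<omega>" z_opt] compact_imp_closed
    unfolding G_def zn_def F_def est_feasible_def by blast+
  have near: "\<exists>\<delta>>0. \<forall>\<omega>. G \<omega> \<longrightarrow> (\<forall>n\<ge>1. small \<delta> n \<omega> \<longrightarrow> dist (zn n \<omega>) z_opt \<le> \<epsilon>)"
    if "\<epsilon> > 0" for \<epsilon>
  proof -
    obtain z where z: "z \<in> Z" "norm (z - z_opt) \<le> \<epsilon>"
      "\<forall>\<xi>\<in>{1..\<Xi>}. sat_prob Y f (\<psi> \<xi>) z x > 1 - \<alpha> \<xi>"
      using slater \<open>\<epsilon> > 0\<close> by blast
    obtain \<delta> where "\<delta> > 0" "\<And>\<omega> n. small \<delta> n \<omega> \<Longrightarrow> z \<in> F n \<omega>"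
      using strictly_feasible_imp_est_feasible[OF z(1,3)] unfolding F_def small_def by meson
    moreover have "dist (zn n \<omega>) z_opt \<le> \<epsilon>" if "G \<omega>" "n \<ge> 1" "z \<in> F n \<omega>" for n \<omega>
      using closest[OF that] z(2) by (simp add: dist_norm norm_minus_commute)
    ultimately show ?thesis by meson
  qed
  have true_loss: "\<exists>\<delta>>0. \<forall>\<omega>. G \<omega> \<longrightarrow> (\<forall>n\<ge>1. small \<delta> n \<omega> \<longrightarrow>
      dist (exp_loss Y f l (zn n \<omega>) x) (exp_loss Y f l z_opt x) \<le> \<epsilon>)" if "\<epsilon> > 0" for \<epsilon>
  proof -
    obtain \<eta> where \<eta>: "\<eta> > 0" "\<And>z. z \<in> Z \<Longrightarrow> dist z z_opt < \<eta> \<Longrightarrow>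
        dist (exp_loss Y f l z x) (exp_loss Y f l z_opt x) < \<epsilon>"
      using cont \<open>z_opt \<in> Z\<close> \<open>\<epsilon> > 0\<close> unfolding continuous_on_iff by meson
    obtain \<delta> where \<delta>: "\<delta> > 0"
      "\<And>\<omega> n. G \<omega> \<Longrightarrow> n \<ge> 1 \<Longrightarrow> small \<delta> n \<omega> \<Longrightarrow> dist (zn n \<omega>) z_opt \<le> \<eta> / 2"
      using near[of "\<eta> / 2"] \<eta>(1) by auto
    have "dist (zn n \<omega>) z_opt < \<eta>" if "G \<omega>" "n \<ge> 1" "small \<delta> n \<omega>" for \<omega> n
      using \<delta>(2)[OF that] \<eta>(1) by linarith
    then show ?thesis using \<delta>(1) \<eta>(2) znZ by (meson less_imp_le)
  qed
  show "\<exists>\<delta>>0. \<forall>\<omega>. G \<omega> \<longrightarrow> (\<forall>n\<ge>1. small \<delta> n \<omega> \<longrightarrow> dist (zn n \<omega>) z_opt \<le> \<epsilon>)"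
    and "\<exists>\<delta>>0. \<forall>\<omega>. G \<omega> \<longrightarrow> (\<forall>n\<ge>1. small \<delta> n \<omega> \<longrightarrow>
          dist (exp_loss Y f l (zn n \<omega>) x) (exp_loss Y f l z_opt x) \<le> \<epsilon>)"
    using near true_loss \<open>\<epsilon> > 0\<close> by blast+
  obtain \<delta> where \<delta>: "\<delta> > 0" "\<And>\<omega> n. G \<omega> \<Longrightarrow> n \<ge> 1 \<Longrightarrow> small \<delta> n \<omega> \<Longrightarrow>
      dist (exp_loss Y f l (zn n \<omega>) x) (exp_loss Y f l z_opt x) \<le> \<epsilon> / 2"
    using true_loss[of "\<epsilon> / 2"] \<open>\<epsilon> > 0\<close> by auto
  show "\<exists>\<delta>>0. \<forall>\<omega>. G \<omega> \<longrightarrow> (\<forall>n\<ge>1. small \<delta> n \<omega> \<longrightarrow>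
          dist (est_loss W ys l n \<omega> (zn n \<omega>) x) (exp_loss Y f l z_opt x) \<le> \<epsilon>)"
  proof (intro exI[of _ "min \<delta> (\<epsilon> / 2)"] conjI allI impI)
    show "min \<delta> (\<epsilon> / 2) > 0" using \<delta>(1) \<open>\<epsilon> > 0\<close> by simp
    fix \<omega> n assume G: "G \<omega>" and n: "n \<ge> 1" and s: "small (min \<delta> (\<epsilon> / 2)) n \<omega>"
    have "small \<delta> n \<omega>" and s2: "small (\<epsilon> / 2) n \<omega>"
      using s unfolding small_def by (auto intro: order_trans[OF _ ennreal_leI])
    then have 1: "dist (exp_loss Y f l (zn n \<omega>) x) (exp_loss Y f l z_opt x) \<le> \<epsilon> / 2"
      using \<delta>(2) G n by blast
    have "sup_dev Z (\<lambda>z. exp_loss Y f l z x) (\<lambda>z. est_loss W ys l n \<omega> z x) \<le> ennreal (\<epsilon> / 2)"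
      using s2[unfolded small_def, rule_format, of 0] by (simp add: deviation_def)
    from sup_dev_leD[OF this _ znZ[OF G n]] 1 \<open>\<epsilon> > 0\<close>
    show "dist (est_loss W ys l n \<omega> (zn n \<omega>) x) (exp_loss Y f l z_opt x) \<le> \<epsilon>"
      unfolding dist_real_def by linarith
  qed
qed


section \<open>Accuracy and optimality\<close>

theorem theorem2:
  fixes Z1 :: "'a::euclidean_space set" and Z2 :: "'b::euclidean_space set"
    and Z :: "('a \<times> 'b) set"
    and X :: "'x::euclidean_space set" and Y :: "'y::euclidean_space set"
    and f :: "('a \<times> 'b) \<times> 'x \<times> 'y \<Rightarrow> real"
    and l :: "'a \<times> 'b \<Rightarrow> 'y \<Rightarrow> real"
    and \<Xi> :: nat and \<alpha> :: "nat \<Rightarrow> real" and \<psi> :: "nat \<Rightarrow> 'a \<times> 'b \<Rightarrow> 'y \<Rightarrow> real"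
    and P :: "'p measure"
    and ZV :: "'p \<Rightarrow> 'a \<times> 'b" and XV :: "'p \<Rightarrow> 'x" and YV :: "'a \<times> 'b \<Rightarrow> 'p \<Rightarrow> 'y"
    and M :: "'w measure"
    and zs :: "nat \<Rightarrow> 'w \<Rightarrow> 'a \<times> 'b" and xs :: "nat \<Rightarrow> 'w \<Rightarrow> 'x" and ys :: "nat \<Rightarrow> 'w \<Rightarrow> 'y"
    and W :: "'w \<Rightarrow> nat \<Rightarrow> nat \<Rightarrow> 'a \<times> 'b \<Rightarrow> 'x \<Rightarrow> real"
    and L\<^sub>f :: real
  assumes "prob_space P" and "prob_space M"
    and "Z = Z1 \<times> Z2"
    and "\<And>\<xi>. \<xi> \<in> {1..\<Xi>} \<Longrightarrow> 0 < \<alpha> \<xi> \<and> \<alpha> \<xi> < 1"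
    and "\<And>z. z \<in> Z \<Longrightarrow> l z \<in> borel_measurable (restrict_space borel Y)"
    and "\<And>\<xi> z. \<xi> \<in> {1..\<Xi>} \<Longrightarrow> z \<in> Z \<Longrightarrow> \<psi> \<xi> z \<in> borel_measurable (restrict_space borel Y)"
    and "outcome_model P Z X Y f ZV XV YV"
    and "weight_function M Z X W"
    and "decomposition_ignorability P Z1 Z2 ZV XV YV"
    and "equicontinuous_in_decision Z Y l"
    and "\<And>\<xi>. \<xi> \<in> {1..\<Xi>} \<Longrightarrow> equicontinuous_in_decision Z Y (\<psi> \<xi>)"
    and "regularity M Z X Y f zs xs ys"
    and "existence M Z X \<Xi> \<alpha> \<psi> ys W"
    and "bounded_tails Z1 Z2 X Y f l"
    and "slater Z X Y f l \<Xi> \<alpha> \<psi>"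
    and "wasserstein_lipschitz L\<^sub>f Z X Y f"
    and "bounded_constraint_densities Z X Y f \<Xi> \<psi>"
  shows "(strongly_uniformly_consistent M Z X Y f l \<Xi> \<psi> ys W \<longrightarrow>
      (\<forall>x\<in>X. \<exists>z_opt zn.
         optimal Z Y f l \<Xi> \<alpha> \<psi> x z_opt \<and>
         (AE \<omega> in M. \<forall>n\<ge>1. zn n \<omega> \<in> est_feasible Z \<Xi> \<alpha> \<psi> W ys n \<omega> x) \<and>
         tends_almost_surely M zn z_opt \<and>
         tends_almost_surely M (\<lambda>n \<omega>. est_loss W ys l n \<omega> (zn n \<omega>) x) (exp_loss Y f l z_opt x) \<and>
         tends_almost_surely M (\<lambda>n \<omega>. exp_loss Y f l (zn n \<omega>) x) (exp_loss Y f l z_opt x))) \<and>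
    (weakly_uniformly_consistent M Z X Y f l \<Xi> \<psi> ys W \<longrightarrow>
      (\<forall>x\<in>X. \<exists>z_opt zn.
         optimal Z Y f l \<Xi> \<alpha> \<psi> x z_opt \<and>
         (AE \<omega> in M. \<forall>n\<ge>1. zn n \<omega> \<in> est_feasible Z \<Xi> \<alpha> \<psi> W ys n \<omega> x) \<and>
         tends_in_prob M zn z_opt \<and>
         tends_in_prob M (\<lambda>n \<omega>. est_loss W ys l n \<omega> (zn n \<omega>) x) (exp_loss Y f l z_opt x) \<and>
         tends_in_prob M (\<lambda>n \<omega>. exp_loss Y f l (zn n \<omega>) x) (exp_loss Y f l z_opt x)))"
proof -
  obtain c C where fc: "0 < c" "\<And>p. p \<in> Z \<times> X \<times> Y \<Longrightarrow> c < f p \<and> f p < C"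
    using \<open>regularity M Z X Y f zs xs ys\<close> unfolding regularity_def by blast
  have reg: "compact X" "compact Y" "compact Z" "continuous_on (Z \<times> X \<times> Y) f"
    "distributed M lborel (\<lambda>\<omega>. (zs 1 \<omega>, xs 1 \<omega>, ys 1 \<omega>)) (joint_density (Z \<times> X \<times> Y) f)"
    "continuous_on (Z \<times> X) (\<lambda>(z, x). marginal_zx Y f z x)"
    using \<open>regularity M Z X Y f zs xs ys\<close> twice_cont_differentiable_on_imp_continuous_on
    unfolding regularity_def by auto
  \<comment> \<open>A single observation suffices to see that the decision and outcome sets have positive volume.\<close>
  note vol = positive_volume_of_joint_density[OF \<open>prob_space M\<close> reg(5) reg(3,1,2)]
  have "Z \<noteq> {}" using vol(1) by auto
  then have "Z1 = fst ` Z" "Z2 = snd ` Z"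
    unfolding \<open>Z = Z1 \<times> Z2\<close> by auto
  then have comp: "compact Z1" "compact Z2"
    using reg(3) by (auto intro!: compact_continuous_image continuous_intros)
  have "emeasure lborel Z = emeasure lborel Z1 * emeasure lborel Z2"
    using comp unfolding \<open>Z = Z1 \<times> Z2\<close> lborel_prod[symmetric]
    by (intro lborel.emeasure_pair_measure_Times) (auto intro: borel_closed compact_imp_closed)
  then have "emeasure lborel Z2 \<noteq> 0" using vol(1) by auto
  then interpret bounded_joint_density Z1 Z2 X Y f c C
    using reg fc comp(2) vol(2) emeasure_compact_finite[OF comp(2)] emeasure_compact_finite[OF reg(2)]
    unfolding \<open>Z = Z1 \<times> Z2\<close>
    by unfold_locales (auto simp: measure_def enn2real_positive_iff less_imp_le zero_less_iff_neq_zero)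
  have meas: "l z \<in> borel_measurable leb_Y" if "z \<in> Z1 \<times> Z2" for z
    using assms(5) that measurable_cong_sets[OF sets_leb_Y refl] unfolding \<open>Z = Z1 \<times> Z2\<close> by blast
  let ?D = "deviation Z Y f l \<psi> W ys"
  \<comment> \<open>One limit and one sequence serve both modes of convergence.\<close>
  have *: "\<exists>z_opt zn. optimal Z Y f l \<Xi> \<alpha> \<psi> x z_opt \<and>
      (AE \<omega> in M. \<forall>n\<ge>1. zn n \<omega> \<in> est_feasible Z \<Xi> \<alpha> \<psi> W ys n \<omega> x) \<and>
      ((\<forall>i\<in>{0..\<Xi>}. tends_almost_surely M (?D x i) 0) \<longrightarrow>
         tends_almost_surely M zn z_opt \<and>
         tends_almost_surely M (\<lambda>n \<omega>. est_loss W ys l n \<omega> (zn n \<omega>) x) (exp_loss Y f l z_opt x) \<and>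
         tends_almost_surely M (\<lambda>n \<omega>. exp_loss Y f l (zn n \<omega>) x) (exp_loss Y f l z_opt x)) \<and>
      ((\<forall>i\<in>{0..\<Xi>}. vanishes_in_prob M (?D x i)) \<longrightarrow>
         tends_in_prob M zn z_opt \<and>
         tends_in_prob M (\<lambda>n \<omega>. est_loss W ys l n \<omega> (zn n \<omega>) x) (exp_loss Y f l z_opt x) \<and>
         tends_in_prob M (\<lambda>n \<omega>. exp_loss Y f l (zn n \<omega>) x) (exp_loss Y f l z_opt x))"
    if x: "x \<in> X" for x
  proof -
    obtain z_opt where opt: "optimal Z Y f l \<Xi> \<alpha> \<psi> x z_opt"
      and slater: "\<forall>\<epsilon>>0. \<exists>z\<in>Z. norm (z - z_opt) \<le> \<epsilon> \<and>
        (\<forall>\<xi>\<in>{1..\<Xi>}. sat_prob Y f (\<psi> \<xi>) z x > 1 - \<alpha> \<xi>)"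
      using \<open>slater Z X Y f l \<Xi> \<alpha> \<psi>\<close> x unfolding slater_def by blast
    have opt_Z: "z_opt \<in> Z"
      using opt by (simp add: optimal_def feasible_def)
    have cont_loss: "continuous_on Z (\<lambda>z. exp_loss Y f l z x)"
      using continuous_on_exp_loss[OF assms(14) meas assms(10)[unfolded \<open>Z = Z1 \<times> Z2\<close>] x]
      unfolding \<open>Z = Z1 \<times> Z2\<close> .
    define G where "G \<omega> \<longleftrightarrow> (\<forall>n\<ge>1. est_feasible Z \<Xi> \<alpha> \<psi> W ys n \<omega> x \<noteq> {} \<and>
      compact (est_feasible Z \<Xi> \<alpha> \<psi> W ys n \<omega> x))" for \<omega>
    have G: "AE \<omega> in M. G \<omega>"
      using \<open>existence M Z X \<Xi> \<alpha> \<psi> ys W\<close> x unfolding existence_def G_def by blast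
    define zn where "zn n \<omega> = closest_point (est_feasible Z \<Xi> \<alpha> \<psi> W ys n \<omega> x) z_opt" for n \<omega>
    have zn: "AE \<omega> in M. \<forall>n\<ge>1. zn n \<omega> \<in> est_feasible Z \<Xi> \<alpha> \<psi> W ys n \<omega> x"
      using G by eventually_elim (unfold G_def zn_def, blast intro: closest_point_in_set compact_imp_closed)
    note control = closest_est_feasible_control[OF slater opt_Z cont_loss, where W=W and ys=ys, folded G_def zn_def]
    note as = tends_almost_surely_of_control[of "{0..\<Xi>}" M "?D x", OF finite_atLeastAtMost _ G]
    note ip = tends_in_prob_of_control[of "{0..\<Xi>}" M "?D x", OF finite_atLeastAtMost _ G]
    show ?thesis
      by (intro exI[of _ z_opt] exI[of _ zn] conjI impI opt zn;
          rule as[OF _ control(1)] as[OF _ control(2)] as[OF _ control(3)]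
               ip[OF _ control(1)] ip[OF _ control(2)] ip[OF _ control(3)]; blast)
  qed
  show ?thesis
  proof (intro conjI impI ballI)
    fix x assume cons: "strongly_uniformly_consistent M Z X Y f l \<Xi> \<psi> ys W" and x: "x \<in> X"
    have "tends_almost_surely M (?D x i) 0" if "i \<in> {0..\<Xi>}" for i
      using cons x that unfolding strongly_uniformly_consistent_def deviation_def[abs_def]
      by (cases "i = 0") auto
    with *[OF x] show "\<exists>z_opt zn.
         optimal Z Y f l \<Xi> \<alpha> \<psi> x z_opt \<and>
         (AE \<omega> in M. \<forall>n\<ge>1. zn n \<omega> \<in> est_feasible Z \<Xi> \<alpha> \<psi> W ys n \<omega> x) \<and>
         tends_almost_surely M zn z_opt \<and>
         tends_almost_surely M (\<lambda>n \<omega>. est_loss W ys l n \<omega> (zn n \<omega>) x) (exp_loss Y f l z_opt x) \<and>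
         tends_almost_surely M (\<lambda>n \<omega>. exp_loss Y f l (zn n \<omega>) x) (exp_loss Y f l z_opt x)"
      by blast
  next
    fix x assume cons: "weakly_uniformly_consistent M Z X Y f l \<Xi> \<psi> ys W" and x: "x \<in> X"
    have "vanishes_in_prob M (?D x i)" if "i \<in> {0..\<Xi>}" for i
      using cons x that unfolding weakly_uniformly_consistent_def deviation_def[abs_def]
      by (cases "i = 0") auto
    with *[OF x] show "\<exists>z_opt zn.
         optimal Z Y f l \<Xi> \<alpha> \<psi> x z_opt \<and>
         (AE \<omega> in M. \<forall>n\<ge>1. zn n \<omega> \<in> est_feasible Z \<Xi> \<alpha> \<psi> W ys n \<omega> x) \<and>
         tends_in_prob M zn z_opt \<and>
         tends_in_prob M (\<lambda>n \<omega>. est_loss W ys l n \<omega> (zn n \<omega>) x) (exp_loss Y f l z_opt x) \<and>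
         tends_in_prob M (\<lambda>n \<omega>. exp_loss Y f l (zn n \<omega>) x) (exp_loss Y f l z_opt x)"
      by blast
  qed
qed

end
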